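(* Let $d\ge1$, let $N$ be a fixed even positive integer, and consider the random matrices $A^\star_{\eta,N}$, $D^{1,\eta}_\rho$ and $D^{2,\eta}_{\rho_1,\rho_2}$ defined in the context. For any entry $ij$ ($1\le i,j\le d$) of the homogenized matrix, we have, as $\eta\to0$, $$\mathrm{Var}\Big[\big(A^\star_{\eta,N}\big)_{ij}\Big]=\eta\,C^0_N+O_N(\eta^2),$$ $$\mathrm{Var}\Big[\big(D^{1,\eta}_{\rho=1}\big)_{ij}\Big]=O_N(\eta^2),$$ $$\mathrm{Var}\Big[\big(D^{2,\eta}_{\rho_1=\rho_2=1}\big)_{ij}\Big]=O_N(\eta^3),$$ where $C^0_N$ is a positive constant (independent of $\eta$).
   Context: Let $Q=(0,1)^d$, $Q_N=(-N/2,N/2)^d$ with $N$ even (so that $Q_N$ is, up to a null set, a union of cells $k+Q$, $k\in\mathbb Z^d$), and $\mathcal I_N=\{k\in\mathbb Z^d:\ Q+k\subset Q_N\}$. Let $A_{\rm per},C_{\rm per}:\mathbb R^d\to\mathbb R^{d\times d}$ be measurable, $\mathbb Z^d$-periodic, bounded, and uniformly elliptic: there is $c>0$ with $\xi^TA_{\rm per}(x)\xi\ge c|\xi|^2$ and $\xi^TC_{\rm per}(x)\xi\ge c|\xi|^2$ for all $\xi\in\mathbb R^d$ and a.e. $x$. For $\eta\in(0,1)$ let $(B^\eta_k)_{k\in\mathbb Z^d}$ be i.i.d. Bernoulli variables, $\mathbb P(B^\eta_k=1)=\eta$, $\mathbb P(B^\eta_k=0)=1-\eta$, and set $$A_\eta(x,\omega)=A_{\rm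 per}(x)+\Big(\sum_{k\in\mathbb Z^d}\mathbf 1_{Q+k}(x)B^\eta_k(\omega)\Big)\big(C_{\rm per}(x)-A_{\rm per}(x)\big).$$ For a bounded, uniformly elliptic matrix field $A$ on $Q_N$ (extended $Q_N$-periodically) and $p\in\mathbb R^d$, let $w^N_p$ be the $Q_N$-periodic weak solution (unique up to an additive constant) of $-\mathrm{div}\big(A(p+\nabla w^N_p)\big)=0$, and define the $d\times d$ matrix $\mathrm{Hom}_N(A)$ by $\mathrm{Hom}_N(A)\,p=\frac1{|Q_N|}\int_{Q_N}A\,(p+\nabla w^N_p)\,dx$ for all $p\in\mathbb R^d$. Then define, for $k,l\in\mathcal I_N$ with $k\ne l$: - $A^\star_{\eta,N}(\omega)=\mathrm{Hom}_N(A_\eta(\cdot,\omega))$, the apparent homogenized matrix; - $A^\star_{\rm per}$: the periodic homogenized matrix, $A^\star_{\rm per}\,p=\int_QA_{\rm per}(p+\nabla w^0_p)\,dx$ with $w^0_p$ the $Q$-periodic solution of $-\mathrm{div}(A_{\rm per}(p+\nabla w^0_p))=0$; - $A^\star_{1,k,N}=\mathrm{Hom}_N\big(A_{\rm per}+\mathbf 1_{k+Q}(C_{\rm per}-A_{\rm per})\big)$, which does not depend on $k$; - $A^\star_{2,k,l,N}=\mathrm{Hom}_N\big(A_{\rm per}+(\mathbf 1_{k+Q}+\mathbf 1_{l+Q})(C_{\rm per}-A_{\rm per})\big)$; - $\overline A^{k,N}_{1\,\rm def}=A^\star_{1,k,N}-A^\star_{\rm per}$ and $\overline A^{k,l,N}_{2\,\rm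 def}=A^\star_{2,k,l,N}-A^\star_{1,k,N}-A^\star_{1,l,N}+A^\star_{\rm per}$; - $\overline A^N_1=\sum_{k\in\mathcal I_N}\overline A^{k,N}_{1\,\rm def}$ and $\overline A^N_2=\frac12\sum_{k,l\in\mathcal I_N,\,k\ne l}\overline A^{k,l,N}_{2\,\rm def}$; - $A^{\eta,N}_1(\omega)=\sum_{k\in\mathcal I_N}B^\eta_k(\omega)\overline A^{k,N}_{1\,\rm def}$ and $A^{\eta,N}_2(\omega)=\frac12\sum_{k\in\mathcal I_N}\sum_{l\in\mathcal I_N,\,l\ne k}B^\eta_k(\omega)B^\eta_l(\omega)\overline A^{k,l,N}_{2\,\rm def}$. The controlled variables are, for deterministic real $\rho,\rho_1,\rho_2$, $$D^{1,\eta}_\rho(\omega)=A^\star_{\eta,N}(\omega)-\rho\big(A^{\eta,N}_1(\omega)-\eta\overline A^N_1\big),$$ $$D^{2,\eta}_{\rho_1,\rho_2}(\omega)=A^\star_{\eta,N}(\omega)-\rho_1\big(A^{\eta,N}_1(\omega)-\eta\overline A^N_1\big)-\rho_2\big(A^{\eta,N}_2(\omega)-\eta^2\overline A^N_2\big).$$ $O_N(\eta^m)$ denotes a quantity bounded by $K_N\eta^m$ as $\eta\to0$, with $K_N$ independent of $\eta$ but possibly depending on $N$.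
   Formalization: Positivity of C^0_N fails in general (if C_per = A_per the variance is 0), so it is proved that C^0_N ≥ 0, and that C^0_N > 0 whenever the ij entry of some one-defect correction A_{1 def}^{k,N} is nonzero. *)

theory Defs
  imports "HOL-Probability.Probability" "HOL-Library.Landau_Symbols"
begin

definition lat :: "int ^ 'd \<Rightarrow> real ^ 'd" where
  "lat k = (\<chi> i. real_of_int (k $ i))"

definition cube :: "real \<Rightarrow> real \<Rightarrow> (real ^ 'd) set" where
  "cube a L = {x. \<forall>i. a < x $ i \<and> x $ i < a + L}"

definition Q :: "(real ^ 'd) set" where
  "Q = cube 0 1"

definition QN :: "nat \<Rightarrow> (real ^ 'd) set" where
  "QN N = cube (- (real N / 2)) (real N)"

definition cell :: "int ^ 'd \<Rightarrow> (real ^ 'd) set" where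
  "cell k = (\<lambda>x. x + lat k) ` Q"

definition IN :: "nat \<Rightarrow> (int ^ 'd) set" where
  "IN N = {k. cell k \<subseteq> QN N}"

definition periodic :: "real \<Rightarrow> (real ^ 'd \<Rightarrow> 'b) \<Rightarrow> bool" where
  "periodic L f \<longleftrightarrow> (\<forall>x k. f (x + L *\<^sub>R lat k) = f x)"

definition L2_loc :: "(real ^ 'd::finite \<Rightarrow> 'b::euclidean_space) \<Rightarrow> bool" where
  "L2_loc f \<longleftrightarrow> f \<in> borel_measurable lebesgue \<and>
     (\<forall>K. compact K \<longrightarrow> set_integrable lebesgue K (\<lambda>x. (norm (f x))\<^sup>2))"

text \<open>
  \<open>G\<close> is (a representative of) the distributional gradient of \<open>u\<close> on the whole space.
  The test functions \<open>\<phi>\<close> are continuously differentiable with compact support, with gradient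
  \<open>D\<close>; the \<open>d\<close> scalar integration-by-parts identities are written as one vector identity.
\<close>

definition weak_gradient :: "(real ^ 'd::finite \<Rightarrow> real) \<Rightarrow> (real ^ 'd \<Rightarrow> real ^ 'd) \<Rightarrow> bool" where
  "weak_gradient u G \<longleftrightarrow>
     (\<forall>\<phi> D. (\<forall>x. GDERIV \<phi> x :> D x) \<longrightarrow> continuous_on UNIV D \<longrightarrow> bounded {x. \<phi> x \<noteq> 0} \<longrightarrow>
        (LINT x|lebesgue. u x *\<^sub>R D x) = - (LINT x|lebesgue. \<phi> x *\<^sub>R G x))"

text \<open>\<open>H1_per L u G\<close>: \<open>u\<close> is an \<open>L\<close>-periodic function in \<open>H\<^sup>1\<^sub>l\<^sub>o\<^sub>c\<close>, with gradient \<open>G\<close>.\<close>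

definition H1_per :: "real \<Rightarrow> (real ^ 'd::finite \<Rightarrow> real) \<Rightarrow> (real ^ 'd \<Rightarrow> real ^ 'd) \<Rightarrow> bool" where
  "H1_per L u G \<longleftrightarrow> periodic L u \<and> L2_loc u \<and> L2_loc G \<and> weak_gradient u G"

text \<open>
  \<open>corrector a L A p w G\<close>: \<open>w\<close>, with gradient \<open>G\<close>, is a periodic weak solution of
  \<open>- div (A (p + \<nabla>w)) = 0\<close>, the periodicity cell being \<open>cube a L\<close>. Only the values of \<open>A\<close> on
  this cube are used, so that \<open>A\<close> need not itself be \<open>L\<close>-periodic: this is the equation for the
  periodic extension of \<open>A\<close> restricted to the cube.
\<close>

definition corrector ::
  "real \<Rightarrow> real \<Rightarrow> (real ^ 'd \<Rightarrow> real ^ 'd ^ 'd) \<Rightarrow> real ^ 'd::finite \<Rightarrow>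
     (real ^ 'd \<Rightarrow> real) \<Rightarrow> (real ^ 'd \<Rightarrow> real ^ 'd) \<Rightarrow> bool" where
  "corrector a L A p w G \<longleftrightarrow> H1_per L w G \<and>
     (\<forall>v V. H1_per L v V \<longrightarrow>
        (LINT x:cube a L|lebesgue. (A x *v (p + G x)) \<bullet> V x) = 0)"

definition hom_matrix :: "real \<Rightarrow> real \<Rightarrow> (real ^ 'd \<Rightarrow> real ^ 'd ^ 'd) \<Rightarrow> real ^ 'd ^ 'd::finite" where
  "hom_matrix a L A = (THE H. \<forall>p. \<exists>w G. corrector a L A p w G \<and>
     H *v p = (1 / measure lebesgue (cube a L :: (real ^ 'd) set)) *\<^sub>R
                (LINT x:cube a L|lebesgue. A x *v (p + G x)))"

definition HomN :: "nat \<Rightarrow> (real ^ 'd \<Rightarrow> real ^ 'd ^ 'd) \<Rightarrow> real ^ 'd ^ 'd::finite" where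
  "HomN N A = hom_matrix (- (real N / 2)) (real N) A"

definition Aper_star :: "(real ^ 'd \<Rightarrow> real ^ 'd ^ 'd) \<Rightarrow> real ^ 'd ^ 'd::finite" where
  "Aper_star A = hom_matrix 0 1 A"

definition elliptic :: "real \<Rightarrow> (real ^ 'd \<Rightarrow> real ^ 'd ^ 'd) \<Rightarrow> bool" where
  "elliptic c A \<longleftrightarrow> (AE x in lebesgue. \<forall>\<xi>. \<xi> \<bullet> (A x *v \<xi>) \<ge> c * (norm \<xi>)\<^sup>2)"

definition iid_bernoulli :: "'w measure \<Rightarrow> real \<Rightarrow> ('k \<Rightarrow> 'w \<Rightarrow> real) \<Rightarrow> bool" where
  "iid_bernoulli M \<eta> B \<longleftrightarrow>
     prob_space.indep_vars M (\<lambda>_. borel) B UNIV \<and>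
     (\<forall>k. (\<forall>\<omega>\<in>space M. B k \<omega> \<in> {0, 1}) \<and>
          measure M {\<omega> \<in> space M. B k \<omega> = 1} = \<eta> \<and>
          measure M {\<omega> \<in> space M. B k \<omega> = 0} = 1 - \<eta>)"

text \<open>
  From here on \<open>A\<close> and \<open>C\<close> stand for the two periodic fields, and \<open>b\<close> is a realization
  \<open>k \<mapsto> B k \<omega>\<close> of the Bernoulli family. The cells are pairwise disjoint, so the lattice sum
  below has at most one nonzero term.
\<close>

definition A_eta ::
  "(real ^ 'd \<Rightarrow> real ^ 'd ^ 'd) \<Rightarrow> (real ^ 'd \<Rightarrow> real ^ 'd ^ 'd) \<Rightarrow> (int ^ 'd \<Rightarrow> real) \<Rightarrow>
     real ^ 'd \<Rightarrow> real ^ 'd ^ 'd::finite" where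
  "A_eta A C b x = A x + (\<Sum>\<^sub>\<infinity>k. indicator (cell k) x * b k) *\<^sub>R (C x - A x)"

definition A_star ::
  "nat \<Rightarrow> (real ^ 'd \<Rightarrow> real ^ 'd ^ 'd) \<Rightarrow> (real ^ 'd \<Rightarrow> real ^ 'd ^ 'd) \<Rightarrow> (int ^ 'd \<Rightarrow> real) \<Rightarrow>
     real ^ 'd ^ 'd::finite" where
  "A_star N A C b = HomN N (A_eta A C b)"

context
  fixes N :: nat and A C :: "real ^ 'd \<Rightarrow> real ^ 'd ^ 'd::finite"
begin

definition A1_star :: "int ^ 'd \<Rightarrow> real ^ 'd ^ 'd" where
  "A1_star k = HomN N (\<lambda>x. A x + indicator (cell k) x *\<^sub>R (C x - A x))"

definition A2_star :: "int ^ 'd \<Rightarrow> int ^ 'd \<Rightarrow> real ^ 'd ^ 'd" where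
  "A2_star k l =
     HomN N (\<lambda>x. A x + (indicator (cell k) x + indicator (cell l) x) *\<^sub>R (C x - A x))"

definition A1_def :: "int ^ 'd \<Rightarrow> real ^ 'd ^ 'd" where
  "A1_def k = A1_star k - Aper_star A"

definition A2_def :: "int ^ 'd \<Rightarrow> int ^ 'd \<Rightarrow> real ^ 'd ^ 'd" where
  "A2_def k l = A2_star k l - A1_star k - A1_star l + Aper_star A"

definition A1_bar :: "real ^ 'd ^ 'd" where
  "A1_bar = (\<Sum>k\<in>IN N. A1_def k)"

definition A2_bar :: "real ^ 'd ^ 'd" where
  "A2_bar = (1/2) *\<^sub>R (\<Sum>k\<in>IN N. \<Sum>l\<in>IN N - {k}. A2_def k l)"

definition A1_eta :: "(int ^ 'd \<Rightarrow> real) \<Rightarrow> real ^ 'd ^ 'd" where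
  "A1_eta b = (\<Sum>k\<in>IN N. b k *\<^sub>R A1_def k)"

definition A2_eta :: "(int ^ 'd \<Rightarrow> real) \<Rightarrow> real ^ 'd ^ 'd" where
  "A2_eta b = (1/2) *\<^sub>R (\<Sum>k\<in>IN N. \<Sum>l\<in>IN N - {k}. (b k * b l) *\<^sub>R A2_def k l)"

definition D1 :: "real \<Rightarrow> real \<Rightarrow> (int ^ 'd \<Rightarrow> real) \<Rightarrow> real ^ 'd ^ 'd" where
  "D1 \<rho> \<eta> b = A_star N A C b - \<rho> *\<^sub>R (A1_eta b - \<eta> *\<^sub>R A1_bar)"

definition D2 :: "real \<Rightarrow> real \<Rightarrow> real \<Rightarrow> (int ^ 'd \<Rightarrow> real) \<Rightarrow> real ^ 'd ^ 'd" where
  "D2 \<rho>1 \<rho>2 \<eta> b = A_star N A C b - \<rho>1 *\<^sub>R (A1_eta b - \<eta> *\<^sub>R A1_bar)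
                                 - \<rho>2 *\<^sub>R (A2_eta b - \<eta>\<^sup>2 *\<^sub>R A2_bar)"

end

end

theory Submission
  imports Defs
begin

text \<open>
  On the cube \<^term>\<open>QN N\<close> the field \<^const>\<open>A_eta\<close> depends on the Bernoulli variables only through the
  random set \<open>T\<close> of those cells of the cube that carry a defect. Each entry of \<^const>\<open>A_star\<close> is
  therefore \<open>F T\<close> for a deterministic real function \<open>F\<close> on the subsets of the finite set
  \<^term>\<open>IN N\<close>. Since \<open>T = S\<close> has probability at most \<open>\<eta>\<close> to the power \<open>card S\<close>,
  a function of \<open>T\<close> that vanishes on all sets with fewer than \<open>m\<close> elements has an expectation of
  order \<open>\<eta>\<^sup>m\<close> (\<open>expectation_vanishing_order\<close>).

  Subtracting \<^const>\<open>A1_eta\<close> with \<open>\<rho> = 1\<close> leaves, up to a deterministic constant, a function of \<open>T\<close>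
  that vanishes on sets with at most one element; subtracting \<^const>\<open>A2_eta\<close> too leaves one that
  vanishes on sets with at most two elements. A variance is at most a second moment, so the two
  controlled variances are of order \<open>\<eta>\<^sup>2\<close> and \<open>\<eta>\<^sup>3\<close>. Without control, the terms of order \<open>\<eta>\<close> come
  from single defects and give the constant \<open>C0 = \<Sum>\<^sub>k (F {k} - F {})\<^sup>2\<close>.

  All this needs the contributions \<^const>\<open>A1_def\<close> and \<^const>\<open>A2_def\<close> to be the finite differences of
  \<open>F\<close>, and these are written with \<^const>\<open>Aper_star\<close>, the homogenized matrix on the unit cell, in place
  of \<open>F {}\<close>, the homogenized matrix of the same field on \<^term>\<open>QN N\<close>. So the analytic core is
  \<open>HomN_periodic\<close>: for a field of period 1 both cubes give the same matrix. A corrector on the unit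
  cell is a corrector on the large cube, because a test function of period \<open>N\<close> may be summed over
  its integer translates; conversely, averaging a corrector of period \<open>N\<close> over its translates gives
  one of period 1. Both constructions preserve the average flux, so a matrix satisfies the
  defining property of the homogenized matrix on one cube if and only if it does so on the other.

  Translating gradients requires that the weak gradient of a periodic function be periodic almost
  everywhere. This is uniqueness of weak gradients, which is the fundamental lemma of the calculus
  of variations.
\<close>

section \<open>The fundamental lemma of the calculus of variations\<close>

definition C1 :: "('a::real_inner \<Rightarrow> real) \<Rightarrow> bool" where
  "C1 \<phi> \<longleftrightarrow> (\<exists>D. (\<forall>x. GDERIV \<phi> x :> D x) \<and> continuous_on UNIV D)"

lemma C1I: "\<lbrakk>\<And>x. GDERIV \<phi> x :> D x; continuous_on UNIV D\<rbrakk> \<Longrightarrow> C1 \<phi>"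
  unfolding C1_def by blast

lemma C1_continuous: "C1 \<phi> \<Longrightarrow> continuous_on UNIV \<phi>"
  unfolding C1_def gderiv_def
  by (meson has_derivative_continuous continuous_at_imp_continuous_on)

lemma C1_mult:
  assumes "C1 \<phi>" "C1 \<psi>" shows "C1 (\<lambda>x. \<phi> x * \<psi> x)"
proof -
  obtain D E where D: "\<And>x. GDERIV \<phi> x :> D x" "continuous_on UNIV D"
    and E: "\<And>x. GDERIV \<psi> x :> E x" "continuous_on UNIV E"
    using assms unfolding C1_def by blast
  show ?thesis
    by (rule C1I[OF GDERIV_mult[OF D(1) E(1)]])
       (intro continuous_intros C1_continuous assms D E)
qed

lemma C1_prod:
  assumes "finite I" "\<And>i. i \<in> I \<Longrightarrow> C1 (\<phi> i)"
  shows "C1 (\<lambda>x. \<Prod>i\<in>I. \<phi> i x)"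
  using assms
proof (induction rule: finite_induct)
  case empty
  show ?case by (simp, rule C1I[where D="\<lambda>_. 0"]) (auto simp: GDERIV_const)
next
  case (insert i I)
  then show ?case by (simp add: C1_mult)
qed

lemma C1_compose:
  assumes "C1 \<phi>" and g: "\<And>x. (g has_real_derivative g' (\<phi> x)) (at (\<phi> x))"
    and g': "continuous_on (range \<phi>) g'"
  shows "C1 (\<lambda>x. g (\<phi> x))"
proof -
  obtain D where D: "\<And>x. GDERIV \<phi> x :> D x" "continuous_on UNIV D"
    using assms unfolding C1_def by blast
  show ?thesis
  proof (rule C1I[OF GDERIV_DERIV_compose[OF D(1) g]])
    have "continuous_on UNIV (\<lambda>x. g' (\<phi> x))"
      using continuous_on_compose[OF C1_continuous[OF assms(1)] g'] by (simp add: o_def)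
    then show "continuous_on UNIV (\<lambda>x. g' (\<phi> x) *\<^sub>R D x)"
      by (intro continuous_intros D)
  qed
qed

text \<open>
  The square makes the positive part continuously differentiable; products of such functions of
  one coordinate are the bump functions below.
\<close>

lemma C1_pos_part_square: "C1 (\<lambda>x::'a::real_inner. (max 0 (x \<bullet> v + t))\<^sup>2)"
proof (rule C1_compose[where g="\<lambda>s. (max 0 s)\<^sup>2" and g'="\<lambda>s. 2 * max 0 s"])
  show "C1 (\<lambda>x. x \<bullet> v + t)"
    by (rule C1I[where D="\<lambda>_. v"]) (auto simp: gderiv_def intro!: derivative_eq_intros)
  have "((\<lambda>s. (max 0 s)\<^sup>2) has_real_derivative 2 * max 0 s) (at s)" for s :: real
  proof -
    consider "s > 0" | "s < 0" | "s = 0" by linarith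
    then show ?thesis
    proof cases
      case 1
      have "((\<lambda>s. s\<^sup>2) has_real_derivative 2 * max 0 s) (at s)"
        using 1 by (auto intro!: derivative_eq_intros)
      then show ?thesis
        by (rule has_field_derivative_transform_within_open[where S="{0<..}"]) (use 1 in auto)
    next
      case 2
      have "((\<lambda>s. 0) has_real_derivative 2 * max 0 s) (at s)"
        using 2 by (auto intro!: derivative_eq_intros)
      then show ?thesis
        by (rule has_field_derivative_transform_within_open[where S="{..<0}"]) (use 2 in auto)
    next
      case 3
      have "((\<lambda>h. (max 0 h)\<^sup>2 / h) \<longlongrightarrow> 0) (at (0::real))"
      proof (rule tendsto_0_le[where K=1])
        show "((\<lambda>h::real. h) \<longlongrightarrow> 0) (at 0)" by (rule tendsto_ident_at)
        show "\<forall>\<^sub>F h in at (0::real). norm ((max 0 h)\<^sup>2 / h) \<le> norm h * 1"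
          by (auto simp: max_def power2_eq_square)
      qed
      then show ?thesis using 3 by (simp add: DERIV_def)
    qed
  qed
  then show "((\<lambda>s. (max 0 s)\<^sup>2) has_real_derivative 2 * max 0 (x \<bullet> v + t)) (at (x \<bullet> v + t))" for x by blast
qed (intro continuous_intros)

lemma C1_bump_box:
  fixes a b :: "'a::euclidean_space"
  obtains \<phi> :: "'a \<Rightarrow> real"
  where "C1 \<phi>" "\<And>x. \<phi> x \<ge> 0" "\<And>x. \<phi> x > 0 \<longleftrightarrow> x \<in> box a b"
proof -
  define \<phi> where "\<phi> x = (\<Prod>i\<in>Basis. (max 0 (x \<bullet> i + (- (a \<bullet> i))))\<^sup>2 * (max 0 (x \<bullet> (- i) + b \<bullet> i))\<^sup>2)" for x
  have 1: "C1 \<phi>"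
    unfolding \<phi>_def by (intro C1_prod C1_mult C1_pos_part_square) auto
  have 2: "\<phi> x \<ge> 0" for x
    unfolding \<phi>_def by (intro prod_nonneg) auto
  have "\<phi> x \<noteq> 0 \<longleftrightarrow> x \<in> box a b" for x
    unfolding \<phi>_def by (auto simp: box_def max_def)
  with 2 have 3: "\<phi> x > 0 \<longleftrightarrow> x \<in> box a b" for x
    by (metis order_less_le)
  show ?thesis using 1 2 3 that by blast
qed

text \<open>
  If \<open>\<phi> \<ge> 0\<close> is a bump function that is positive exactly on the box, then the test functions
  \<open>n \<phi> / (1 + n \<phi>)\<close> increase to the indicator of the box, and dominated convergence carries the
  hypothesis on test functions over to the box.
\<close>

lemma lebesgue_integral_box_eq_0:
  fixes f :: "'a::euclidean_space \<Rightarrow> 'b::euclidean_space"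
  assumes int: "\<And>K. compact K \<Longrightarrow> set_integrable lebesgue K f"
    and f: "f \<in> borel_measurable lebesgue"
    and test: "\<And>\<phi>. \<lbrakk>C1 \<phi>; bounded {x. \<phi> x \<noteq> 0}\<rbrakk> \<Longrightarrow> (LINT x|lebesgue. \<phi> x *\<^sub>R f x) = 0"
  shows "(LINT x:box a b|lebesgue. f x) = 0"
proof -
  obtain \<phi> :: "'a \<Rightarrow> real" where C: "C1 \<phi>" and nn: "\<And>x. \<phi> x \<ge> 0" and pos: "\<And>x. \<phi> x > 0 \<longleftrightarrow> x \<in> box a b"
    using C1_bump_box[of a b] by blast
  define \<psi> where "\<psi> n x = real n * \<phi> x / (1 + real n * \<phi> x)" for n x
  have le1: "\<bar>\<psi> n x\<bar> \<le> indicator (box a b) x" for n x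
  proof (cases "x \<in> box a b")
    case True
    then have "\<phi> x > 0" using pos by blast
    then show ?thesis using True by (auto simp: \<psi>_def divide_simps add_pos_nonneg)
  next
    case False
    then have "\<phi> x = 0" using pos nn by (metis order_less_le)
    then show ?thesis by (simp add: \<psi>_def)
  qed
  have CC: "C1 (\<psi> n)" for n
    unfolding \<psi>_def
  proof (rule C1_compose[OF C, where g="\<lambda>t. real n * t / (1 + real n * t)" and g'="\<lambda>t. real n / (1 + real n * t)\<^sup>2"])
    have ne: "1 + real n * \<phi> x > 0" for x using nn[of x] by (simp add: add_pos_nonneg)
    show "((\<lambda>t. real n * t / (1 + real n * t)) has_real_derivative real n / (1 + real n * \<phi> x)\<^sup>2) (at (\<phi> x))" for x
      using ne[of x] by (auto intro!: derivative_eq_intros simp: field_simps power2_eq_square)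
    show "continuous_on (range \<phi>) (\<lambda>t. real n / (1 + real n * t)\<^sup>2)"
      using ne by (intro continuous_intros) (force simp: less_le)
  qed
  have lim: "(\<lambda>n. \<psi> n x) \<longlonglongrightarrow> indicator (box a b) x" for x
  proof (cases "x \<in> box a b")
    case True
    then have "\<phi> x > 0" using pos by blast
    then have "\<forall>\<^sub>F n in sequentially. \<phi> x / (inverse (real n) + \<phi> x) = real n * \<phi> x / (1 + real n * \<phi> x)"
      by (intro eventually_sequentiallyI[of 1]) (simp add: field_simps)
    moreover have "(\<lambda>n. \<phi> x / (inverse (real n) + \<phi> x)) \<longlonglongrightarrow> \<phi> x / (0 + \<phi> x)"
      using \<open>\<phi> x > 0\<close> by (intro tendsto_intros lim_inverse_n) auto
    ultimately have "(\<lambda>n. real n * \<phi> x / (1 + real n * \<phi> x)) \<longlonglongrightarrow> 1"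
      using \<open>\<phi> x > 0\<close> by (auto dest: Lim_transform_eventually[rotated])
    then show ?thesis using True by (simp add: \<psi>_def)
  next
    case False
    then have "\<phi> x = 0" using pos nn by (metis order_less_le)
    then show ?thesis using False by (simp add: \<psi>_def)
  qed
  have intb: "set_integrable lebesgue (box a b) f"
    by (rule set_integrable_subset[OF int[OF compact_cbox[of a b]]]) (auto simp: box_subset_cbox)
  have meas: "\<psi> n \<in> borel_measurable lebesgue" for n
    using C1_continuous[OF CC[of n]]
    by (simp add: borel_measurable_continuous_onI measurable_completion)
  have "(\<lambda>n. LINT x|lebesgue. \<psi> n x *\<^sub>R f x) \<longlonglongrightarrow> (LINT x|lebesgue. indicator (box a b) x *\<^sub>R f x)"
  proof (rule integral_dominated_convergence)
    show "integrable lebesgue (\<lambda>x. norm (indicator (box a b) x *\<^sub>R f x))"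
      using intb unfolding set_integrable_def by (rule integrable_norm)
    show "AE x in lebesgue. (\<lambda>n. \<psi> n x *\<^sub>R f x) \<longlonglongrightarrow> indicator (box a b) x *\<^sub>R f x"
      by (intro AE_I2 tendsto_intros lim)
    show "AE x in lebesgue. norm (\<psi> n x *\<^sub>R f x) \<le> norm (indicat_real (box a b) x *\<^sub>R f x)" for n
      using le1 by (intro AE_I2) (auto intro!: mult_right_mono)
  qed (use f meas intb in \<open>auto intro!: borel_measurable_scaleR simp: set_integrable_def\<close>)
  moreover have "(LINT x|lebesgue. \<psi> n x *\<^sub>R f x) = 0" for n
  proof (rule test[OF CC])
    have "{x. \<psi> n x \<noteq> 0} \<subseteq> box a b"
    proof
      fix x assume "x \<in> {x. \<psi> n x \<noteq> 0}"
      then show "x \<in> box a b" using le1[of n x] by (cases "x \<in> box a b") auto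
    qed
    then show "bounded {x. \<psi> n x \<noteq> 0}" using bounded_subset bounded_box by blast
  qed
  ultimately show ?thesis by (simp add: set_lebesgue_integral_def LIMSEQ_const_iff)
qed

lemma sigma_finite_lebesgue: "sigma_finite_measure (lebesgue :: 'a::euclidean_space measure)"
proof -
  obtain A :: "'a set set" where "countable A" "A \<subseteq> sets lborel" "\<Union>A = space lborel"
    "\<forall>a\<in>A. emeasure lborel a \<noteq> \<infinity>"
    using lborel.sigma_finite_countable by blast
  then show ?thesis
    by (intro sigma_finite_measure.intro exI[of _ A]) (auto simp: subset_iff)
qed

text \<open>
  Boxes are stable under intersection and generate the Borel sets, so by Dynkin's theorem the
  integral of \<open>f\<close> over every measurable subset of a bounded box vanishes.
\<close>

lemma AE_eq_0_if_box_integrals_eq_0: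
  fixes f :: "'a::euclidean_space \<Rightarrow> 'b::euclidean_space"
  assumes int: "\<And>K. compact K \<Longrightarrow> set_integrable lebesgue K f"
    and box0: "\<And>a b. (LINT x:box a b|lebesgue. f x) = 0"
  shows "AE x in lebesgue. f x = 0"
proof -
  have *: "AE x in lebesgue. indicator (box a b) x *\<^sub>R f x = 0" for a b :: 'a
  proof (rule sigma_finite_measure.density_zero)
    define h where "h = (\<lambda>x. indicator (box a b) x *\<^sub>R f x)"
    show "sigma_finite_measure (lebesgue :: 'a measure)" by (rule sigma_finite_lebesgue)
    have inth: "integrable lebesgue h"
      using set_integrable_subset[OF int[OF compact_cbox[of a b]], of "box a b"]
      by (auto simp: box_subset_cbox set_integrable_def h_def)
    then show "integrable lebesgue (\<lambda>x. indicator (box a b) x *\<^sub>R f x)" by (simp add: h_def)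
    have inthA: "integrable lebesgue (\<lambda>x. indicator A x *\<^sub>R h x)" if "A \<in> sets lebesgue" for A
      using integrable_mult_indicator[OF that inth] .
    have borel: "(LINT x|lebesgue. indicator A x *\<^sub>R h x) = 0" if A: "A \<in> sets borel" for A
    proof -
      have "Int_stable (range (\<lambda>(a, b). box a b :: 'a set))"
        by (auto simp: Int_stable_def box_Int_box)
      moreover have "range (\<lambda>(a, b). box a b :: 'a set) \<subseteq> Pow UNIV" by simp
      moreover have "A \<in> sigma_sets UNIV (range (\<lambda>(a, b). box a b :: 'a set))"
        using A by (simp add: borel_eq_box)
      ultimately show ?thesis
      proof (induction rule: sigma_sets_induct_disjoint)
        case (basic A)
        then obtain u v where "A = box u v" by auto
        then have "indicator A x *\<^sub>R h x = indicator (A \<inter> box a b) x *\<^sub>R f x" for x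
          by (auto simp: h_def indicator_def)
        moreover obtain p q where "A \<inter> box a b = box p q"
          using \<open>A = box u v\<close> by (auto simp: box_Int_box)
        ultimately show ?case using box0[of p q] by (simp add: set_lebesgue_integral_def)
      next
        case (compl A)
        then have A: "A \<in> sets lebesgue"
          using borel_eq_box by (metis sets_completionI_sets sets_lborel sets_measure_of subset_UNIV Pow_UNIV)
        have "(LINT x|lebesgue. indicator (UNIV - A) x *\<^sub>R h x)
            = (LINT x|lebesgue. h x - indicator A x *\<^sub>R h x)"
          by (intro Bochner_Integration.integral_cong) (auto simp: indicator_def)
        also have "\<dots> = (LINT x|lebesgue. h x) - (LINT x|lebesgue. indicator A x *\<^sub>R h x)"
          by (intro Bochner_Integration.integral_diff inth inthA A)
        also have "(LINT x|lebesgue. h x) = 0"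
          using box0[of a b] by (simp add: set_lebesgue_integral_def h_def)
        finally show ?case using compl by simp
      next
        case (union A)
        then have A: "A i \<in> sets lebesgue" for i
          using borel_eq_box by (metis sets_completionI_sets sets_lborel sets_measure_of subset_UNIV Pow_UNIV range_subsetD)
        have "(LINT x:(\<Union>i. A i)|lebesgue. h x) = (\<Sum>i. (LINT x:(A i)|lebesgue. h x))"
          using A union(1) inthA
          by (intro lebesgue_integral_countable_add)
             (auto simp: disjoint_family_on_def set_integrable_def)
        then show ?case using union by (simp add: set_lebesgue_integral_def)
      qed simp
    qed
    fix A :: "'a set" assume A: "A \<in> sets lebesgue"
    then obtain S N N' where SN: "A = S \<union> N" "N \<subseteq> N'" "N' \<in> null_sets lborel" "S \<in> sets lborel"
      by (rule sets_completionE)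
    have "AE x in lebesgue. x \<notin> N'"
      using SN(3) by (intro AE_completion AE_not_in)
    then have "AE x in lebesgue. indicator A x *\<^sub>R h x = indicator S x *\<^sub>R h x"
      using SN(1,2) by (elim AE_mp, intro AE_I2) (auto simp: indicator_def)
    then have "(LINT x|lebesgue. indicator A x *\<^sub>R h x) = (LINT x|lebesgue. indicator S x *\<^sub>R h x)"
      using A SN(4) inthA
      by (intro integral_cong_AE) (auto intro: borel_measurable_integrable)
    also have "\<dots> = 0" using borel SN(4) by simp
    finally show "(LINT x:A|lebesgue. indicator (box a b) x *\<^sub>R f x) = 0"
      by (simp add: set_lebesgue_integral_def h_def)
  qed
  have "AE x in lebesgue. \<forall>n::nat. indicator (box (- real n *\<^sub>R One) (real n *\<^sub>R One)) x *\<^sub>R f x = 0"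
    using * by (intro AE_all_countable[THEN iffD2]) auto
  then show ?thesis
  proof (rule AE_mp, intro AE_I2 impI)
    fix x :: 'a assume x: "\<forall>n::nat. indicator (box (- real n *\<^sub>R One) (real n *\<^sub>R One)) x *\<^sub>R f x = 0"
    obtain n where "\<forall>i\<in>Basis. \<bar>x \<bullet> i\<bar> < real n"
      using reals_Archimedean2[of "norm x"] Basis_le_norm[of _ x] by (meson le_less_trans)
    then have "x \<in> box (- real n *\<^sub>R One) (real n *\<^sub>R One)"
      by (force simp: box_def abs_less_iff)
    then show "f x = 0" using x[rule_format, of n] by (simp only: indicator_simps scaleR_one)
  qed
qed

section \<open>Locally square-integrable functions and periodic Sobolev functions\<close>

lemma
  fixes a :: "'a::euclidean_space"
  shows lebesgue_measurable_plus: "(\<lambda>x. x + a) \<in> lebesgue \<rightarrow>\<^sub>M lebesgue"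
    and lebesgue_distr_plus: "distr lebesgue lebesgue (\<lambda>x. x + a) = lebesgue"
proof -
  have T: "(\<lambda>x. a + (\<Sum>j\<in>Basis. (1 * (x \<bullet> j)) *\<^sub>R j)) = (\<lambda>x. x + a)"
    by (simp add: euclidean_representation add.commute)
  show "(\<lambda>x. x + a) \<in> lebesgue \<rightarrow>\<^sub>M lebesgue"
    using lebesgue_affine_measurable[of "\<lambda>_. 1" a] unfolding T by simp
  show "distr lebesgue lebesgue (\<lambda>x. x + a) = lebesgue"
    using lebesgue_affine_euclidean[of "\<lambda>_. 1" a] unfolding T by (simp add: density_1)
qed

lemma
  fixes f :: "'a::euclidean_space \<Rightarrow> 'b::{banach, second_countable_topology}"
  assumes f: "f \<in> borel_measurable lebesgue"
  shows borel_measurable_lebesgue_shift: "(\<lambda>x. f (x + a)) \<in> borel_measurable lebesgue"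
    and lebesgue_integral_shift: "(LINT x|lebesgue. f (x + a)) = (LINT x|lebesgue. f x)"
    and lebesgue_integrable_shift: "integrable lebesgue (\<lambda>x. f (x + a)) \<longleftrightarrow> integrable lebesgue f"
proof -
  show "(\<lambda>x. f (x + a)) \<in> borel_measurable lebesgue"
    by (rule measurable_compose[OF lebesgue_measurable_plus f])
  show "(LINT x|lebesgue. f (x + a)) = (LINT x|lebesgue. f x)"
    using integral_distr[OF lebesgue_measurable_plus f, of a] unfolding lebesgue_distr_plus by simp
  show "integrable lebesgue (\<lambda>x. f (x + a)) \<longleftrightarrow> integrable lebesgue f"
    using integrable_distr_eq[OF lebesgue_measurable_plus f, of a] unfolding lebesgue_distr_plus by simp
qed

lemma L2_loc_measurable: "L2_loc f \<Longrightarrow> f \<in> borel_measurable lebesgue"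
  by (simp add: L2_loc_def)

lemma compact_sets_lebesgue: "compact (K :: 'a::euclidean_space set) \<Longrightarrow> K \<in> sets lebesgue"
  by (simp add: borel_compact)

text \<open>
  A dominating function \<open>g\<close> for the square of the norm is the convenient criterion: it covers sums,
  multiples and products with bounded matrix fields.
\<close>

lemma L2_loc_bound:
  fixes f :: "real ^ 'd::finite \<Rightarrow> 'b::euclidean_space"
  assumes f: "f \<in> borel_measurable lebesgue"
    and g: "\<And>K. compact K \<Longrightarrow> set_integrable lebesgue K g"
    and le: "\<And>x. (norm (f x))\<^sup>2 \<le> g x"
  shows "L2_loc f"
  unfolding L2_loc_def
proof (intro conjI allI impI f)
  fix K :: "(real ^ 'd) set" assume K: "compact K"
  show "set_integrable lebesgue K (\<lambda>x. (norm (f x))\<^sup>2)"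
    unfolding set_integrable_def
  proof (rule Bochner_Integration.integrable_bound[OF g[OF K, unfolded set_integrable_def]])
    show "(\<lambda>x. indicat_real K x *\<^sub>R (norm (f x))\<^sup>2) \<in> borel_measurable lebesgue"
      using f compact_sets_lebesgue[OF K] by measurable
    show "AE x in lebesgue. norm (indicat_real K x *\<^sub>R (norm (f x))\<^sup>2) \<le> norm (indicat_real K x *\<^sub>R g x)"
      using le by (intro AE_I2) (auto simp: indicator_def intro: order_trans[OF le abs_ge_self])
  qed
qed

lemma L2_loc_set_integrable_norm_sq:
  "L2_loc f \<Longrightarrow> compact K \<Longrightarrow> set_integrable lebesgue K (\<lambda>x. (norm (f x))\<^sup>2)"
  by (simp add: L2_loc_def)

lemma L2_loc_const:
  fixes c :: "'b::euclidean_space"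
  shows "L2_loc (\<lambda>_ :: real ^ 'd::finite. c)"
proof (rule L2_loc_bound[where g="\<lambda>_. (norm c)\<^sup>2"])
  fix K :: "(real ^ 'd) set" assume "compact K"
  then have "integrable lebesgue (indicator K :: _ \<Rightarrow> real)"
    using lmeasurable_compact[of K] by (intro integrable_real_indicator) (auto simp: fmeasurable_def)
  then show "set_integrable lebesgue K (\<lambda>_. (norm c)\<^sup>2)"
    unfolding set_integrable_def by (rule integrable_scaleR_left)
qed auto

lemma L2_loc_add:
  fixes f g :: "real ^ 'd::finite \<Rightarrow> 'b::euclidean_space"
  assumes "L2_loc f" "L2_loc g" shows "L2_loc (\<lambda>x. f x + g x)"
proof (rule L2_loc_bound[where g="\<lambda>x. 2 * (norm (f x))\<^sup>2 + 2 * (norm (g x))\<^sup>2"])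
  show "(\<lambda>x. f x + g x) \<in> borel_measurable lebesgue"
    using assms by (intro borel_measurable_add L2_loc_measurable)
  show "set_integrable lebesgue K (\<lambda>x. 2 * (norm (f x))\<^sup>2 + 2 * (norm (g x))\<^sup>2)" if "compact K" for K
    using assms that by (intro set_integral_add set_integrable_mult_right L2_loc_set_integrable_norm_sq) auto
  show "(norm (f x + g x))\<^sup>2 \<le> 2 * (norm (f x))\<^sup>2 + 2 * (norm (g x))\<^sup>2" for x
  proof -
    have "(norm (f x + g x))\<^sup>2 \<le> (norm (f x) + norm (g x))\<^sup>2"
      by (intro power_mono norm_triangle_ineq) auto
    also have "\<dots> \<le> 2 * (norm (f x))\<^sup>2 + 2 * (norm (g x))\<^sup>2"
      using sum_squares_bound[of "norm (f x)" "norm (g x)"] by (simp add: power2_sum)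
    finally show ?thesis .
  qed
qed

lemma bounded_bilinear_matrix_vector_mult:
  "bounded_bilinear (\<lambda>(A :: real ^ 'n ^ 'm) (v :: real ^ 'n). A *v v)"
  unfolding bilinear_conv_bounded_bilinear[symmetric] bilinear_def
  by (auto intro!: linearI simp: matrix_vector_mult_add_rdistrib scaleR_matrix_vector_assoc
      matrix_vector_right_distrib matrix_vector_mult_scaleR)

lemma L2_loc_matrix_vector_mult:
  fixes A :: "real ^ 'd::finite \<Rightarrow> real ^ 'd ^ 'd"
  assumes A: "A \<in> borel_measurable lebesgue" "bounded (range A)" and F: "L2_loc F"
  shows "L2_loc (\<lambda>x. A x *v F x)"
proof -
  obtain K where K: "\<And>(A :: real ^ 'd ^ 'd) v. norm (A *v v) \<le> norm A * norm v * K" "K \<ge> 0"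
    using bounded_bilinear.nonneg_bounded[OF bounded_bilinear_matrix_vector_mult] by blast
  obtain C where C: "\<And>x. norm (A x) \<le> C" using A(2) by (auto simp: bounded_iff)
  have C0: "C \<ge> 0" using C[of 0] norm_ge_zero order_trans by blast
  show ?thesis
  proof (rule L2_loc_bound[where g="\<lambda>x. (C * K)\<^sup>2 * (norm (F x))\<^sup>2"])
    show "(\<lambda>x. A x *v F x) \<in> borel_measurable lebesgue"
      by (rule borel_measurable_continuous_Pair[OF A(1) L2_loc_measurable[OF F]])
         (intro bounded_bilinear.continuous_on[OF bounded_bilinear_matrix_vector_mult] continuous_intros)
    show "set_integrable lebesgue K' (\<lambda>x. (C * K)\<^sup>2 * (norm (F x))\<^sup>2)" if "compact K'" for K'
      using F that by (intro set_integrable_mult_right L2_loc_set_integrable_norm_sq)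
    show "(norm (A x *v F x))\<^sup>2 \<le> (C * K)\<^sup>2 * (norm (F x))\<^sup>2" for x
    proof -
      have "norm (A x *v F x) \<le> C * norm (F x) * K"
        using K(1)[of "A x" "F x"] mult_right_mono[OF mult_right_mono[OF C[of x] norm_ge_zero[of "F x"]] K(2)] by linarith
      then have "(norm (A x *v F x))\<^sup>2 \<le> (C * norm (F x) * K)\<^sup>2" by (intro power_mono) auto
      then show ?thesis by (simp add: power_mult_distrib ac_simps)
    qed
  qed
qed

lemma L2_loc_scaleR:
  fixes f :: "real ^ 'd::finite \<Rightarrow> 'b::euclidean_space"
  assumes "L2_loc f" shows "L2_loc (\<lambda>x. c *\<^sub>R f x)"
proof (rule L2_loc_bound[where g="\<lambda>x. c\<^sup>2 * (norm (f x))\<^sup>2"])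
  show "set_integrable lebesgue K (\<lambda>x. c\<^sup>2 * (norm (f x))\<^sup>2)" if "compact K" for K
    using assms that by (intro set_integrable_mult_right L2_loc_set_integrable_norm_sq)
  show "(\<lambda>x. c *\<^sub>R f x) \<in> borel_measurable lebesgue"
    using L2_loc_measurable[OF assms] by measurable
qed (simp add: power_mult_distrib)

lemma L2_loc_shift:
  fixes f :: "real ^ 'd::finite \<Rightarrow> 'b::euclidean_space"
  assumes "L2_loc f" shows "L2_loc (\<lambda>x. f (x + a))"
  unfolding L2_loc_def
proof (intro conjI allI impI)
  show "(\<lambda>x. f (x + a)) \<in> borel_measurable lebesgue"
    using assms by (intro borel_measurable_lebesgue_shift L2_loc_measurable)
  fix K :: "(real ^ 'd) set" assume K: "compact K"
  define K' where "K' = (\<lambda>x. x + a) ` K"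
  have K': "compact K'" unfolding K'_def using K by (intro compact_continuous_image continuous_intros)
  have eq: "indicat_real K x = indicator K' (x + a)" for x by (auto simp: K'_def indicator_def)
  have "integrable lebesgue (\<lambda>x. indicat_real K' x *\<^sub>R (norm (f x))\<^sup>2)"
    using L2_loc_set_integrable_norm_sq[OF assms K'] by (simp add: set_integrable_def)
  then have "integrable lebesgue (\<lambda>x. indicat_real K' (x + a) *\<^sub>R (norm (f (x + a)))\<^sup>2)"
    using borel_measurable_integrable by (subst lebesgue_integrable_shift) auto
  then show "set_integrable lebesgue K (\<lambda>x. (norm (f (x + a)))\<^sup>2)"
    by (simp add: set_integrable_def eq)
qed

lemma L2_loc_inner_integrable:
  fixes f g :: "real ^ 'd::finite \<Rightarrow> 'b::euclidean_space"
  assumes "L2_loc f" "L2_loc g" "bounded S" "S \<in> sets lebesgue"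
  shows "set_integrable lebesgue S (\<lambda>x. f x \<bullet> g x)"
proof -
  define K where "K = closure S"
  have K: "compact K" "S \<subseteq> K" using assms(3) by (auto simp: K_def closure_subset)
  have "set_integrable lebesgue K (\<lambda>x. (norm (f x))\<^sup>2 + (norm (g x))\<^sup>2)"
    using assms K by (intro set_integral_add L2_loc_set_integrable_norm_sq)
  then have "set_integrable lebesgue K (\<lambda>x. f x \<bullet> g x)"
    unfolding set_integrable_def
  proof (rule Bochner_Integration.integrable_bound)
    show "(\<lambda>x. indicat_real K x *\<^sub>R (f x \<bullet> g x)) \<in> borel_measurable lebesgue"
      using assms(1,2)[THEN L2_loc_measurable] compact_sets_lebesgue[OF K(1)] by measurable
    have "\<bar>f x \<bullet> g x\<bar> \<le> (norm (f x))\<^sup>2 + (norm (g x))\<^sup>2" for x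
      using Cauchy_Schwarz_ineq2[of "f x" "g x"] sum_squares_bound[of "norm (f x)" "norm (g x)"]
        mult_nonneg_nonneg[of "norm (f x)" "norm (g x)"] by simp
    then show "AE x in lebesgue. norm (indicat_real K x *\<^sub>R (f x \<bullet> g x))
        \<le> norm (indicat_real K x *\<^sub>R ((norm (f x))\<^sup>2 + (norm (g x))\<^sup>2))"
      by (intro AE_I2) (auto simp: indicator_def)
  qed
  then show ?thesis by (rule set_integrable_subset) (use K assms in auto)
qed

lemma L2_loc_set_integrable:
  fixes f :: "real ^ 'd::finite \<Rightarrow> 'b::euclidean_space"
  assumes "L2_loc f" "bounded S" "S \<in> sets lebesgue"
  shows "set_integrable lebesgue S f"
proof -
  have "set_integrable lebesgue S (\<lambda>x. f x \<bullet> b)" for b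
    using L2_loc_inner_integrable[OF assms(1) L2_loc_const assms(2,3)] .
  then have "integrable lebesgue (\<lambda>x. \<Sum>b\<in>Basis. (indicator S x *\<^sub>R (f x \<bullet> b)) *\<^sub>R b)"
    unfolding set_integrable_def
    by (intro Bochner_Integration.integrable_sum integrable_scaleR_left)
  moreover have "(\<Sum>b\<in>Basis. (indicator S x *\<^sub>R (f x \<bullet> b)) *\<^sub>R b) = indicator S x *\<^sub>R f x" for x
    by (simp add: scaleR_scaleR[symmetric] scaleR_sum_right[symmetric] euclidean_representation del: scaleR_scaleR)
  ultimately show ?thesis by (simp add: set_integrable_def)
qed

text \<open>
  The derivative of a test function vanishes off the support of the function, so both integrands
  in the definition of \<^const>\<open>weak_gradient\<close> live on a compact set. This integrability is what makes
  that definition linear in \<open>u\<close> and \<open>G\<close>.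
\<close>

lemma test_function_integrable:
  fixes u :: "real ^ 'd::finite \<Rightarrow> real" and G :: "real ^ 'd \<Rightarrow> real ^ 'd"
  assumes \<phi>: "\<And>x. GDERIV \<phi> x :> D x" "continuous_on UNIV D" "bounded {x. \<phi> x \<noteq> 0}"
    and u: "L2_loc u" and G: "L2_loc G"
  shows "integrable lebesgue (\<lambda>x. u x *\<^sub>R D x)" "integrable lebesgue (\<lambda>x. \<phi> x *\<^sub>R G x)"
proof -
  define K where "K = closure {x. \<phi> x \<noteq> 0}"
  have K: "compact K" using \<phi>(3) by (simp add: K_def)
  have off\<phi>: "\<phi> x = 0" if "x \<notin> K" for x
    using that closure_subset[of "{x. \<phi> x \<noteq> 0}"] unfolding K_def by auto
  \<comment> \<open>The complement of \<open>K\<close> is open and \<open>\<phi>\<close> vanishes on it, which determines the derivative.\<close>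
  have offD: "D x = 0" if "x \<notin> K" for x
  proof -
    have "((\<lambda>x. 0) has_derivative (\<lambda>h. h \<bullet> D x)) (at x)"
      by (rule has_derivative_transform_within_open[OF \<phi>(1)[of x, unfolded gderiv_def], where s="- K"])
         (use that off\<phi> K in \<open>auto simp: compact_imp_closed open_Compl\<close>)
    then have "(\<lambda>h. h \<bullet> D x) = (\<lambda>h. 0)"
      by (rule has_derivative_unique) auto
    then have "D x \<bullet> D x = 0" by meson
    then show ?thesis by simp
  qed
  have c\<phi>: "continuous_on UNIV \<phi>"
    using C1_continuous[of \<phi>] C1I[of \<phi> D] \<phi> by blast
  obtain B where B: "\<And>x. x \<in> K \<Longrightarrow> norm (D x) \<le> B"
    using compact_continuous_image[OF continuous_on_subset[OF \<phi>(2)] K, THEN compact_imp_bounded]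
    by (auto simp: bounded_iff)
  obtain B' where B': "\<And>x. x \<in> K \<Longrightarrow> norm (\<phi> x) \<le> B'"
    using compact_continuous_image[OF continuous_on_subset[OF c\<phi>] K, THEN compact_imp_bounded]
    by (auto simp: bounded_iff)
  have iK: "set_integrable lebesgue K u" "set_integrable lebesgue K G"
    using u G K by (auto intro!: L2_loc_set_integrable compact_sets_lebesgue compact_imp_bounded)
  have meas: "\<phi> \<in> borel_measurable lebesgue" "D \<in> borel_measurable lebesgue"
    using c\<phi> \<phi>(2) by (simp_all add: borel_measurable_continuous_onI measurable_completion)
  show "integrable lebesgue (\<lambda>x. u x *\<^sub>R D x)"
  proof (rule Bochner_Integration.integrable_bound)
    show "integrable lebesgue (\<lambda>x. B *\<^sub>R (indicator K x *\<^sub>R u x))"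
      by (rule integrable_scaleR_right[OF iK(1)[unfolded set_integrable_def]])
    show "(\<lambda>x. u x *\<^sub>R D x) \<in> borel_measurable lebesgue"
      using L2_loc_measurable[OF u] meas by (intro borel_measurable_scaleR) auto
    show "AE x in lebesgue. norm (u x *\<^sub>R D x) \<le> norm (B *\<^sub>R indicat_real K x *\<^sub>R u x)"
    proof (rule AE_I2)
      fix x show "norm (u x *\<^sub>R D x) \<le> norm (B *\<^sub>R indicat_real K x *\<^sub>R u x)"
        using mult_right_mono[OF order_trans[OF B abs_ge_self], of x "\<bar>u x\<bar>"] offD[of x]
        by (cases "x \<in> K") (auto simp: abs_mult mult.commute)
    qed
  qed
  show "integrable lebesgue (\<lambda>x. \<phi> x *\<^sub>R G x)"
  proof (rule Bochner_Integration.integrable_bound)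
    show "integrable lebesgue (\<lambda>x. B' *\<^sub>R (indicator K x *\<^sub>R G x))"
      by (rule integrable_scaleR_right[OF iK(2)[unfolded set_integrable_def]])
    show "(\<lambda>x. \<phi> x *\<^sub>R G x) \<in> borel_measurable lebesgue"
      using L2_loc_measurable[OF G] meas by (intro borel_measurable_scaleR) auto
    show "AE x in lebesgue. norm (\<phi> x *\<^sub>R G x) \<le> norm (B' *\<^sub>R indicat_real K x *\<^sub>R G x)"
    proof (rule AE_I2)
      fix x show "norm (\<phi> x *\<^sub>R G x) \<le> norm (B' *\<^sub>R indicat_real K x *\<^sub>R G x)"
        using mult_right_mono[OF order_trans[OF B' abs_ge_self], of x "norm (G x)"] off\<phi>[of x]
        by (cases "x \<in> K") auto
    qed
  qed
qed

lemma weak_gradient_unique: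
  assumes "weak_gradient u G" "weak_gradient u G'" "L2_loc u" "L2_loc G" "L2_loc G'"
  shows "AE x in lebesgue. G x = G' x"
proof -
  have L: "L2_loc (\<lambda>x. G x + (-1) *\<^sub>R G' x)"
    using assms by (intro L2_loc_add L2_loc_scaleR)
  have "AE x in lebesgue. G x + (-1) *\<^sub>R G' x = 0"
  proof (intro AE_eq_0_if_box_integrals_eq_0 lebesgue_integral_box_eq_0)
    show int: "set_integrable lebesgue K (\<lambda>x. G x + (-1) *\<^sub>R G' x)" if "compact K" for K
      by (rule L2_loc_set_integrable[OF L compact_imp_bounded[OF that] compact_sets_lebesgue[OF that]])
    then show "set_integrable lebesgue K (\<lambda>x. G x + (-1) *\<^sub>R G' x)" if "compact K" for K
      using that .
    show "(\<lambda>x. G x + (-1) *\<^sub>R G' x) \<in> borel_measurable lebesgue" by (rule L2_loc_measurable[OF L])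
    fix \<phi> :: "real ^ 'a \<Rightarrow> real" assume "C1 \<phi>" and b: "bounded {x. \<phi> x \<noteq> 0}"
    then obtain D where D: "\<And>x. GDERIV \<phi> x :> D x" "continuous_on UNIV D" by (auto simp: C1_def)
    have "(LINT x|lebesgue. \<phi> x *\<^sub>R (G x + (-1) *\<^sub>R G' x))
        = (LINT x|lebesgue. \<phi> x *\<^sub>R G x - \<phi> x *\<^sub>R G' x)"
      by (simp add: scaleR_diff_right)
    also have "\<dots> = (LINT x|lebesgue. \<phi> x *\<^sub>R G x) - (LINT x|lebesgue. \<phi> x *\<^sub>R G' x)"
      using test_function_integrable(2)[OF D b] assms by (intro Bochner_Integration.integral_diff) auto
    also have "(LINT x|lebesgue. \<phi> x *\<^sub>R G x) = (LINT x|lebesgue. \<phi> x *\<^sub>R G' x)"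
      using assms(1,2)[unfolded weak_gradient_def, rule_format, OF D b] by simp
    finally show "(LINT x|lebesgue. \<phi> x *\<^sub>R (G x + (-1) *\<^sub>R G' x)) = 0" by simp
  qed
  then show ?thesis by (rule AE_mp) (intro AE_I2, simp)
qed

text \<open>
  A translation of \<open>u\<close> is moved to the test function by the translation invariance of the integral.
\<close>

lemma weak_gradient_shift:
  assumes u: "L2_loc u" and G: "L2_loc G" and w: "weak_gradient u G"
  shows "weak_gradient (\<lambda>x. u (x + a)) (\<lambda>x. G (x + a))"
  unfolding weak_gradient_def
proof (intro allI impI)
  fix \<phi> :: "real ^ 'a \<Rightarrow> real" and D
  assume \<phi>: "\<forall>x. GDERIV \<phi> x :> D x" "continuous_on UNIV D" "bounded {x. \<phi> x \<noteq> 0}"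
  define \<psi> E where "\<psi> = (\<lambda>x. \<phi> (x - a))" and "E = (\<lambda>x. D (x - a))"
  have 1: "GDERIV \<psi> x :> E x" for x
  proof -
    have "((\<lambda>x. x - a) has_derivative (\<lambda>h. h)) (at x)"
      by (auto intro!: derivative_eq_intros)
    from has_derivative_compose[OF this \<phi>(1)[rule_format, of "x - a", unfolded gderiv_def]]
    show ?thesis by (simp add: gderiv_def \<psi>_def E_def)
  qed
  have 2: "continuous_on UNIV E"
    unfolding E_def by (rule continuous_on_compose2[OF \<phi>(2)]) (auto intro!: continuous_intros)
  have "{x. \<psi> x \<noteq> 0} = (\<lambda>x. a + x) ` {x. \<phi> x \<noteq> 0}"
    by (auto simp: \<psi>_def image_iff intro!: exI[of _ "_ - a"])
  then have 3: "bounded {x. \<psi> x \<noteq> 0}" using bounded_translation[OF \<phi>(3)] by simp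
  note int = test_function_integrable[OF 1 2 3 u G, THEN borel_measurable_integrable]
  have "(LINT x|lebesgue. u (x + a) *\<^sub>R D x) = (LINT x|lebesgue. u (x + a) *\<^sub>R E (x + a))"
    by (simp add: E_def)
  also have "\<dots> = (LINT x|lebesgue. u x *\<^sub>R E x)"
    using lebesgue_integral_shift[OF int(1)] .
  also have "\<dots> = - (LINT x|lebesgue. \<psi> x *\<^sub>R G x)"
    using w 1 2 3 unfolding weak_gradient_def by blast
  also have "(LINT x|lebesgue. \<psi> x *\<^sub>R G x) = (LINT x|lebesgue. \<psi> (x + a) *\<^sub>R G (x + a))"
    using lebesgue_integral_shift[OF int(2)] by simp
  finally show "(LINT x|lebesgue. u (x + a) *\<^sub>R D x) = - (LINT x|lebesgue. \<phi> x *\<^sub>R G (x + a))"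
    by (simp add: \<psi>_def)
qed

lemma H1_per_zero: "H1_per L (\<lambda>_. 0) (\<lambda>_. 0)"
  by (simp add: H1_per_def periodic_def weak_gradient_def L2_loc_const)

lemma H1_per_add:
  assumes "H1_per L u G" "H1_per L v H"
  shows "H1_per L (\<lambda>x. u x + v x) (\<lambda>x. G x + H x)"
proof -
  have "weak_gradient (\<lambda>x. u x + v x) (\<lambda>x. G x + H x)"
    unfolding weak_gradient_def
  proof (intro allI impI)
    fix \<phi> :: "real ^ 'a \<Rightarrow> real" and D
    assume \<phi>: "\<forall>x. GDERIV \<phi> x :> D x" "continuous_on UNIV D" "bounded {x. \<phi> x \<noteq> 0}"
    note int = test_function_integrable[OF \<phi>(1)[rule_format] \<phi>(2,3)]
    have "(LINT x|lebesgue. (u x + v x) *\<^sub>R D x)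
        = (LINT x|lebesgue. u x *\<^sub>R D x) + (LINT x|lebesgue. v x *\<^sub>R D x)"
      unfolding scaleR_left_distrib using assms
      by (intro Bochner_Integration.integral_add int) (auto simp: H1_per_def)
    also have "\<dots> = - ((LINT x|lebesgue. \<phi> x *\<^sub>R G x) + (LINT x|lebesgue. \<phi> x *\<^sub>R H x))"
      using assms \<phi> by (simp add: H1_per_def weak_gradient_def)
    also have "(LINT x|lebesgue. \<phi> x *\<^sub>R G x) + (LINT x|lebesgue. \<phi> x *\<^sub>R H x)
        = (LINT x|lebesgue. \<phi> x *\<^sub>R (G x + H x))"
      unfolding scaleR_right_distrib using assms
      by (intro Bochner_Integration.integral_add[symmetric] int) (auto simp: H1_per_def)
    finally show "(LINT x|lebesgue. (u x + v x) *\<^sub>R D x) = - (LINT x|lebesgue. \<phi> x *\<^sub>R (G x + H x))" .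
  qed
  then show ?thesis using assms by (auto simp: H1_per_def periodic_def intro: L2_loc_add)
qed

lemma H1_per_scaleR:
  assumes "H1_per L u G"
  shows "H1_per L (\<lambda>x. c * u x) (\<lambda>x. c *\<^sub>R G x)"
proof -
  have "weak_gradient (\<lambda>x. c * u x) (\<lambda>x. c *\<^sub>R G x)"
    unfolding weak_gradient_def
  proof (intro allI impI)
    fix \<phi> :: "real ^ 'a \<Rightarrow> real" and D
    assume \<phi>: "\<forall>x. GDERIV \<phi> x :> D x" "continuous_on UNIV D" "bounded {x. \<phi> x \<noteq> 0}"
    have "(LINT x|lebesgue. (c * u x) *\<^sub>R D x) = c *\<^sub>R (LINT x|lebesgue. u x *\<^sub>R D x)"
      unfolding scaleR_scaleR[symmetric] by (rule integral_scaleR_right)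
    also have "\<dots> = - (c *\<^sub>R (LINT x|lebesgue. \<phi> x *\<^sub>R G x))"
      using assms \<phi> by (simp add: H1_per_def weak_gradient_def)
    also have "c *\<^sub>R (LINT x|lebesgue. \<phi> x *\<^sub>R G x) = (LINT x|lebesgue. \<phi> x *\<^sub>R (c *\<^sub>R G x))"
      unfolding scaleR_left_commute[of _ c] by (rule integral_scaleR_right[symmetric])
    finally show "(LINT x|lebesgue. (c * u x) *\<^sub>R D x) = - (LINT x|lebesgue. \<phi> x *\<^sub>R (c *\<^sub>R G x))" .
  qed
  moreover have "L2_loc (\<lambda>x. c *\<^sub>R u x)" using assms by (intro L2_loc_scaleR) (simp add: H1_per_def)
  ultimately show ?thesis using assms by (auto simp: H1_per_def periodic_def intro: L2_loc_scaleR)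
qed

lemma H1_per_shift:
  assumes "H1_per L u G" shows "H1_per L (\<lambda>x. u (x + a)) (\<lambda>x. G (x + a))"
proof -
  have "u (x + L *\<^sub>R lat k + a) = u (x + a)" for x k
    using assms by (metis H1_per_def periodic_def add.assoc add.commute)
  then show ?thesis
    using assms by (simp add: H1_per_def periodic_def L2_loc_shift weak_gradient_shift)
qed

lemma H1_per_sum:
  assumes "finite I" "\<And>k. k \<in> I \<Longrightarrow> H1_per L (u k) (G k)"
  shows "H1_per L (\<lambda>x. \<Sum>k\<in>I. u k x) (\<lambda>x. \<Sum>k\<in>I. G k x)"
  using assms by (induction rule: finite_induct) (auto simp: H1_per_zero H1_per_add)

text \<open>
  Periodicity is only required of \<open>u\<close> in \<^const>\<open>H1_per\<close>; a translate of \<open>G\<close> by a period is another weak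
  gradient of \<open>u\<close>.
\<close>

lemma H1_per_gradient_periodic:
  assumes "H1_per L u G"
  shows "AE x in lebesgue. G (x + L *\<^sub>R lat k) = G x"
proof (rule weak_gradient_unique)
  have "(\<lambda>x. u (x + L *\<^sub>R lat k)) = u"
    using assms by (simp add: H1_per_def periodic_def)
  then show "weak_gradient u (\<lambda>x. G (x + L *\<^sub>R lat k))"
    using weak_gradient_shift[of u G "L *\<^sub>R lat k"] assms by (simp add: H1_per_def)
qed (use assms in \<open>auto simp: H1_per_def intro: L2_loc_shift\<close>)

lemma lat_scale: "lat (\<chi> i. int N * k $ i) = real N *\<^sub>R lat k"
  by (simp add: lat_def vec_eq_iff)

lemma lat_add: "lat (k + l) = lat k + lat l"
  by (simp add: lat_def vec_eq_iff)

lemma periodic_1_imp_periodic_N: "periodic 1 u \<Longrightarrow> periodic (real N) u"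
  unfolding periodic_def by (simp flip: lat_scale)

lemma H1_per_1_imp_N: "H1_per 1 u G \<Longrightarrow> H1_per (real N) u G"
  by (simp add: H1_per_def periodic_1_imp_periodic_N)

section \<open>Cells and homogenization of periodic fields on larger cubes\<close>

lemma mem_cell: "x \<in> cell k \<longleftrightarrow> (\<forall>i. real_of_int (k $ i) < x $ i \<and> x $ i < real_of_int (k $ i) + 1)"
proof -
  have "x \<in> cell k \<longleftrightarrow> x - lat k \<in> Q"
    by (auto simp: cell_def image_iff intro: bexI[of _ "x - lat k"])
  then show ?thesis by (auto simp: Q_def cube_def lat_def algebra_simps)
qed

lemma cell_unique: "x \<in> cell k \<Longrightarrow> x \<in> cell l \<Longrightarrow> k = l"
  unfolding mem_cell vec_eq_iff by (metis floor_unique less_imp_le)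

lemma cube_eq_box: "cube a L = box (\<chi> i. a) (\<chi> i. a + L)"
  by (auto simp: cube_def mem_box_cart)

lemma bounded_cube: "bounded (cube a L)"
  by (simp add: cube_eq_box)

lemma cube_lebesgue: "cube a L \<in> sets lebesgue"
  by (simp add: cube_eq_box)

lemma cell_eq_box: "cell k = box (lat k) (lat k + 1)"
  by (auto simp: mem_cell mem_box_cart lat_def)

lemma cell_lebesgue: "cell k \<in> sets lebesgue"
  by (simp add: cell_eq_box)

lemma AE_in_some_cell: "AE x :: real ^ 'd::finite in lebesgue. \<exists>k. x \<in> cell k"
proof -
  have "AE x :: real ^ 'd in lebesgue. \<forall>i. \<forall>n::int. x $ i \<noteq> real_of_int n"
  proof -
    have "AE x in lebesgue. x $ i \<noteq> real_of_int n" for i :: 'd and n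
    proof -
      have "{x :: real ^ 'd. x $ i = real_of_int n} \<in> null_sets lebesgue"
        using negligible_standard_hyperplane[of "axis i 1 :: real ^ 'd" "real_of_int n"]
        by (simp add: negligible_iff_null_sets inner_axis axis_in_Basis_iff)
      from AE_not_in[OF this] show ?thesis by simp
    qed
    then show ?thesis by (simp add: AE_all_countable)
  qed
  then show ?thesis
  proof (rule AE_mp, intro AE_I2 impI)
    fix x :: "real ^ 'd" assume x: "\<forall>i. \<forall>n::int. x $ i \<noteq> real_of_int n"
    have "x \<in> cell (\<chi> i. \<lfloor>x $ i\<rfloor>)"
      unfolding mem_cell
    proof
      fix i
      have "x $ i \<noteq> real_of_int \<lfloor>x $ i\<rfloor>" using x by blast
      then show "real_of_int ((\<chi> i. \<lfloor>x $ i\<rfloor>) $ i) < x $ i \<and> x $ i < real_of_int ((\<chi> i. \<lfloor>x $ i\<rfloor>) $ i) + 1"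
        by simp linarith
    qed
    then show "\<exists>k. x \<in> cell k" by blast
  qed
qed

context
  fixes N :: nat
  assumes N: "N > 0" "even N"
begin

lemma IN_iff_meets:
  assumes x: "x \<in> cell k" "x \<in> QN N"
  shows "\<forall>i. - (int N div 2) \<le> k $ i \<and> k $ i < int N div 2"
proof
  fix i
  define m where "m = int N div 2"
  have m: "real N / 2 = real_of_int m"
    using N(2) by (auto simp: m_def elim: evenE)
  have "real_of_int (k $ i) < x $ i" "x $ i < real_of_int (k $ i) + 1"
    "- real_of_int m < x $ i" "x $ i < real_of_int m"
    using x m by (auto simp: mem_cell QN_def cube_def)
  then show "- (int N div 2) \<le> k $ i \<and> k $ i < int N div 2"
    unfolding m_def[symmetric] by linarith
qed

lemma IN_iff: "k \<in> IN N \<longleftrightarrow> (\<forall>i. - (int N div 2) \<le> k $ i \<and> k $ i < int N div 2)"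
proof
  assume k: "k \<in> IN N"
  define x where "x = (\<chi> i. real_of_int (k $ i) + 1 / 2)"
  have "x \<in> cell k" by (simp add: x_def mem_cell)
  moreover have "x \<in> QN N" using calculation k by (auto simp: IN_def)
  ultimately show "\<forall>i. - (int N div 2) \<le> k $ i \<and> k $ i < int N div 2" by (rule IN_iff_meets)
next
  define m where "m = int N div 2"
  have m: "real N / 2 = real_of_int m" "real N = 2 * real_of_int m"
    using N(2) by (auto simp: m_def elim: evenE)
  assume k: "\<forall>i. - (int N div 2) \<le> k $ i \<and> k $ i < int N div 2"
  show "k \<in> IN N"
    unfolding IN_def
  proof (rule CollectI, rule subsetI)
    fix x assume x: "x \<in> cell k"
    show "x \<in> QN N"
      unfolding QN_def cube_def mem_Collect_eq
    proof
      fix i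
      have "real_of_int (k $ i) < x $ i" "x $ i < real_of_int (k $ i) + 1"
        using x by (auto simp: mem_cell)
      moreover have "- m \<le> k $ i" "k $ i < m" using k by (auto simp: m_def)
      ultimately show "- (real N / 2) < x $ i \<and> x $ i < - (real N / 2) + real N"
        using m by linarith
    qed
  qed
qed

lemma cell_meets_QN: "x \<in> cell k \<Longrightarrow> x \<in> QN N \<Longrightarrow> k \<in> IN N"
  using IN_iff_meets IN_iff by blast

lemma finite_IN: "finite (IN N)"
proof -
  have "inj_on vec_nth (IN N)" by (auto simp: inj_on_def vec_eq_iff)
  moreover have "vec_nth ` IN N \<subseteq> (\<Pi>\<^sub>E i\<in>UNIV. {- (int N div 2)..<int N div 2})"
    by (auto simp: IN_iff)
  then have "finite (vec_nth ` IN N)"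
    by (rule finite_subset) (intro finite_PiE, auto)
  ultimately show ?thesis by (rule finite_imageD[rotated])
qed

lemma IN_nonempty: "IN N \<noteq> ({} :: (int ^ 'd) set)"
proof -
  have "int N div 2 > 0" using N by (auto elim!: evenE)
  then have "0 \<in> (IN N :: (int ^ 'd) set)" by (simp add: IN_iff)
  then show ?thesis by blast
qed

text \<open>
  \<^term>\<open>IN N\<close> is a full set of representatives of the lattice modulo \<open>N\<close>. The reindexing function wraps
  each coordinate back into the range from \<open>-N/2\<close> to \<open>N/2 - 1\<close>.
\<close>

lemma sum_IN_shift:
  fixes g :: "int ^ 'd \<Rightarrow> 'b::comm_monoid_add"
  assumes g: "\<And>k l. g (k + (\<chi> i. int N * l $ i)) = g k"
  shows "(\<Sum>k\<in>IN N. g (k + e)) = (\<Sum>k\<in>IN N. g k)"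
proof -
  define m where "m = int N div 2"
  have N2: "int N = 2 * m" "m > 0" using N by (auto simp: m_def elim!: evenE)
  define wrap :: "int ^ 'd \<Rightarrow> int ^ 'd" where "wrap k = (\<chi> i. (k $ i + m) mod int N - m)" for k
  have wrap_IN: "wrap k \<in> IN N" for k
    using N2 unfolding IN_iff m_def[symmetric]
    by (auto simp: wrap_def)
  have wrap_wrap: "wrap (wrap (k + e) + e') = k" if "k \<in> IN N" "e + e' = 0" for k e e'
    unfolding vec_eq_iff
  proof
    fix i
    have "e $ i + e' $ i = 0" using that(2) by (metis vector_add_component zero_index)
    then have e': "e' $ i = - e $ i" by simp
    have k: "- m \<le> k $ i" "k $ i < m" using that(1) by (auto simp: IN_iff m_def)
    have "((k $ i + e $ i + m) mod int N - m + e' $ i + m) mod int N = (k $ i + m) mod int N"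
      by (simp add: e' mod_simps algebra_simps)
    also have "\<dots> = k $ i + m" using k N2 by (intro mod_pos_pos_trivial) auto
    finally show "wrap (wrap (k + e) + e') $ i = k $ i" by (simp add: wrap_def)
  qed
  have g_wrap: "g (wrap k) = g k" for k
  proof -
    have "wrap k = k + (\<chi> i. int N * (- ((k $ i + m) div int N)))"
      unfolding wrap_def vec_eq_iff
      by (auto simp: minus_mult_div_eq_mod[symmetric])
    also have "\<dots> = k + (\<chi> i. int N * (\<chi> i. - ((k $ i + m) div int N)) $ i)" by simp
    finally show ?thesis using g by metis
  qed
  show ?thesis
    by (rule sum.reindex_bij_witness[where i="\<lambda>k. wrap (k + - e)" and j="\<lambda>k. wrap (k + e)"])
       (auto simp: wrap_IN wrap_wrap g_wrap simp del: add_uminus_conv_diff)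
qed

lemma set_integral_QN_cells:
  fixes f :: "real ^ 'd::finite \<Rightarrow> 'b::euclidean_space"
  assumes f: "f \<in> borel_measurable lebesgue" and int: "set_integrable lebesgue (QN N) f"
  shows "(LINT x:QN N|lebesgue. f x) = (\<Sum>k\<in>IN N. LINT x:Q|lebesgue. f (x + lat k))"
proof -
  have fin: "finite (IN N :: (int ^ 'd) set)" by (rule finite_IN)
  have ic: "integrable lebesgue (\<lambda>x. indicator (cell k) x *\<^sub>R f x)" if "k \<in> IN N" for k
    using set_integrable_subset[OF int cell_lebesgue[of k]] that by (auto simp: IN_def set_integrable_def)
  have "AE x in lebesgue. indicator (QN N) x *\<^sub>R f x = (\<Sum>k\<in>IN N. indicator (cell k) x *\<^sub>R f x)"
    using AE_in_some_cell
  proof (rule AE_mp, intro AE_I2 impI)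
    fix x :: "real ^ 'd" assume "\<exists>k. x \<in> cell k"
    then obtain k where k: "x \<in> cell k" by blast
    have ind: "indicator (cell l) x = (if l = k then 1 else 0 :: real)" for l
    proof (cases "l = k")
      case False
      then have "x \<notin> cell l" using cell_unique[OF k] by blast
      then show ?thesis using False by simp
    qed (use k in simp)
    have "x \<in> QN N \<longleftrightarrow> k \<in> IN N"
    proof
      show "k \<in> IN N" if "x \<in> QN N" by (rule cell_meets_QN[OF k that])
      show "x \<in> QN N" if "k \<in> IN N" using that k unfolding IN_def by blast
    qed
    then show "indicator (QN N) x *\<^sub>R f x = (\<Sum>k\<in>IN N. indicator (cell k) x *\<^sub>R f x)"
      using fin by (simp add: ind if_distrib[of "\<lambda>c. c *\<^sub>R f x"] cong: if_cong)
  qed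
  then have "(LINT x:QN N|lebesgue. f x) = (LINT x|lebesgue. (\<Sum>k\<in>IN N. indicator (cell k) x *\<^sub>R f x))"
    unfolding set_lebesgue_integral_def
    using int ic
    by (intro integral_cong_AE) (auto simp: set_integrable_def intro!: borel_measurable_sum borel_measurable_integrable)
  also have "\<dots> = (\<Sum>k\<in>IN N. LINT x|lebesgue. indicator (cell k) x *\<^sub>R f x)"
    by (rule Bochner_Integration.integral_sum[OF ic])
  also have "\<dots> = (\<Sum>k\<in>IN N. LINT x:Q|lebesgue. f (x + lat k))"
  proof (rule sum.cong[OF refl])
    fix k :: "int ^ 'd" assume "k \<in> IN N"
    have eq: "indicator (cell k) (x + lat k) = (indicator Q x :: real)" for x
      by (auto simp: cell_def indicator_def)
    show "(LINT x|lebesgue. indicator (cell k) x *\<^sub>R f x) = (LINT x:Q|lebesgue. f (x + lat k))"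
      using lebesgue_integral_shift[OF borel_measurable_integrable[OF ic[OF \<open>k \<in> IN N\<close>]], of "lat k"]
      by (simp add: eq set_lebesgue_integral_def)
  qed
  finally show ?thesis .
qed

lemma measure_QN:
  "measure lebesgue (QN N :: (real ^ 'd::finite) set) = real (card (IN N :: (int ^ 'd) set)) * measure lebesgue (Q :: (real ^ 'd) set)"
proof -
  have "set_integrable lebesgue (QN N :: (real ^ 'd) set) (\<lambda>_. 1 :: real)"
    by (auto simp: QN_def intro: L2_loc_set_integrable L2_loc_const bounded_cube cube_lebesgue)
  from set_integral_QN_cells[OF _ this]
  show ?thesis by (simp add: set_lebesgue_integral_def)
qed

text \<open>
  Translating the sum by an integer vector permutes its terms modulo the period \<open>N\<close>.
\<close>

lemma H1_per_sum_translates: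
  assumes "H1_per (real N) u G"
  shows "H1_per 1 (\<lambda>x. \<Sum>k\<in>IN N. u (x + lat k)) (\<lambda>x. \<Sum>k\<in>IN N. G (x + lat k))"
proof -
  have "H1_per (real N) (\<lambda>x. \<Sum>k\<in>IN N. u (x + lat k)) (\<lambda>x. \<Sum>k\<in>IN N. G (x + lat k))"
    by (rule H1_per_sum[OF finite_IN H1_per_shift[OF assms]])
  moreover have "(\<Sum>k\<in>IN N. u (x + 1 *\<^sub>R lat e + lat k)) = (\<Sum>k\<in>IN N. u (x + lat k))" for x e
  proof -
    have "u (x + lat (k + (\<chi> i. int N * l $ i))) = u (x + lat k)" for k l
      using assms by (simp add: H1_per_def periodic_def lat_add lat_scale add.assoc[symmetric])
    from sum_IN_shift[of "\<lambda>k. u (x + lat k)" e, OF this]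
    show ?thesis by (simp add: lat_add ac_simps)
  qed
  ultimately show ?thesis by (simp add: H1_per_def periodic_def)
qed

end

lemma periodic_1_lat: "periodic 1 A \<Longrightarrow> A (x + lat k) = A x"
  unfolding periodic_def by simp

text \<open>
  The two sides define the homogenized matrix (applied to \<open>p\<close>) on the large cube and on the unit
  cell. In one direction the corrector is kept and the test function is summed over translates; in
  the other the corrector is averaged over translates and the test function is kept. In both, the
  gradient that has period 1 is pulled out of the sum over cells.
\<close>

lemma corrector_value_cell_iff:
  fixes A :: "real ^ 'd::finite \<Rightarrow> real ^ 'd ^ 'd" and N :: nat
  assumes N: "N > 0" "even N"
    and A: "A \<in> borel_measurable lebesgue" "periodic 1 A" "bounded (range A)"
  shows "(\<exists>w G. corrector (- (real N / 2)) (real N) A p w G \<and>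
           y = (1 / measure lebesgue (QN N :: (real ^ 'd) set)) *\<^sub>R (LINT x:QN N|lebesgue. A x *v (p + G x)))
     \<longleftrightarrow> (\<exists>w G. corrector 0 1 A p w G \<and>
           y = (1 / measure lebesgue (Q :: (real ^ 'd) set)) *\<^sub>R (LINT x:Q|lebesgue. A x *v (p + G x)))"
    (is "?lhs \<longleftrightarrow> ?rhs")
proof -
  define I :: "(int ^ 'd) set" where "I = IN N"
  define n where "n = real (card I)"
  have n: "n > 0" using finite_IN[OF N] IN_nonempty[OF N] by (auto simp: n_def I_def card_gt_0_iff)
  have finI: "finite I" by (simp add: I_def finite_IN[OF N])
  have mQN: "measure lebesgue (QN N :: (real ^ 'd) set) = n * measure lebesgue (Q :: (real ^ 'd) set)"
    using measure_QN[OF N] by (simp add: n_def I_def)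
  have bS: "bounded (QN N :: (real ^ 'd) set)" "QN N \<in> sets (lebesgue :: (real ^ 'd) measure)"
      "bounded (Q :: (real ^ 'd) set)" "Q \<in> sets (lebesgue :: (real ^ 'd) measure)"
    by (auto simp: QN_def Q_def bounded_cube cube_lebesgue)
  have flux: "L2_loc (\<lambda>x. A x *v (p + G x))" if "L2_loc G"
    for G :: "real ^ 'd \<Rightarrow> real ^ 'd"
    by (rule L2_loc_matrix_vector_mult[OF A(1,3) L2_loc_add[OF L2_loc_const that]])
  have flux_shift: "L2_loc (\<lambda>x. A x *v (p + G (x + a)))" if "L2_loc G"
    for G :: "real ^ 'd \<Rightarrow> real ^ 'd" and a
    by (rule flux[OF L2_loc_shift[OF that]])
  have H1L2: "L2_loc G" if "H1_per L u G"
    for L and u :: "real ^ 'd \<Rightarrow> real" and G using that by (simp add: H1_per_def)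
  have cells_flux: "(LINT x:QN N|lebesgue. A x *v (p + G x))
      = (\<Sum>k\<in>I. LINT x:Q|lebesgue. A x *v (p + G (x + lat k)))" if "L2_loc G"
    for G :: "real ^ 'd \<Rightarrow> real ^ 'd"
    using set_integral_QN_cells[OF N L2_loc_measurable[OF flux[OF that]] L2_loc_set_integrable[OF flux[OF that] bS(1,2)]]
    by (simp add: I_def periodic_1_lat[OF A(2)])
  have cells_energy: "(LINT x:QN N|lebesgue. (A x *v (p + G x)) \<bullet> V x)
      = (\<Sum>k\<in>I. LINT x:Q|lebesgue. (A x *v (p + G (x + lat k))) \<bullet> V (x + lat k))"
    if "L2_loc G" "L2_loc V" for G V :: "real ^ 'd \<Rightarrow> real ^ 'd"
    using set_integral_QN_cells[OF N _ L2_loc_inner_integrable[OF flux[OF that(1)] that(2) bS(1,2)]]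
      borel_measurable_inner[OF flux[OF that(1), THEN L2_loc_measurable] that(2)[THEN L2_loc_measurable]]
    by (simp add: I_def periodic_1_lat[OF A(2)])
  have cong: "(LINT x:Q|lebesgue. f x) = (LINT x:Q|lebesgue. g x)"
    if "f \<in> borel_measurable lebesgue" "g \<in> borel_measurable lebesgue" "AE x in lebesgue. f x = g x"
    for f g :: "real ^ 'd \<Rightarrow> 'z::euclidean_space"
    using that bS(4) by (intro set_lebesgue_integral_cong_AE) auto
  show ?thesis
  proof
    assume ?rhs
    then obtain w G where wG: "H1_per 1 w G"
      and test: "\<And>v V. H1_per 1 v V \<Longrightarrow> (LINT x:Q|lebesgue. (A x *v (p + G x)) \<bullet> V x) = 0"
      and y: "y = (1 / measure lebesgue (Q :: (real ^ 'd) set)) *\<^sub>R (LINT x:Q|lebesgue. A x *v (p + G x))"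
      unfolding corrector_def Q_def by blast
    have G: "L2_loc G" by (rule H1L2[OF wG])
    have Gper: "AE x in lebesgue. G (x + lat k) = G x" for k
      using H1_per_gradient_periodic[OF wG, of k] by simp
    have "corrector (- (real N / 2)) (real N) A p w G"
      unfolding corrector_def QN_def[symmetric]
    proof (intro conjI allI impI)
      show "H1_per (real N) w G" by (rule H1_per_1_imp_N[OF wG])
      fix v :: "real ^ 'd \<Rightarrow> real" and V assume vV: "H1_per (real N) v V"
      have V: "L2_loc V" by (rule H1L2[OF vV])
      have "(LINT x:QN N|lebesgue. (A x *v (p + G x)) \<bullet> V x)
          = (\<Sum>k\<in>I. LINT x:Q|lebesgue. (A x *v (p + G (x + lat k))) \<bullet> V (x + lat k))"
        by (rule cells_energy[OF G V])
      also have "\<dots> = (\<Sum>k\<in>I. LINT x:Q|lebesgue. (A x *v (p + G x)) \<bullet> V (x + lat k))"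
      proof (rule sum.cong[OF refl], rule cong)
        fix k
        show "AE x in lebesgue. (A x *v (p + G (x + lat k))) \<bullet> V (x + lat k) = (A x *v (p + G x)) \<bullet> V (x + lat k)"
          using Gper[of k] by (rule AE_mp) (intro AE_I2, simp)
      qed (rule borel_measurable_inner[OF flux_shift[OF G, THEN L2_loc_measurable] L2_loc_shift[OF V, THEN L2_loc_measurable]]
          borel_measurable_inner[OF flux[OF G, THEN L2_loc_measurable] L2_loc_shift[OF V, THEN L2_loc_measurable]])+
      also have "\<dots> = (LINT x:Q|lebesgue. (\<Sum>k\<in>I. (A x *v (p + G x)) \<bullet> V (x + lat k)))"
        using L2_loc_inner_integrable[OF flux[OF G] L2_loc_shift[OF V] bS(3,4)]
        unfolding set_lebesgue_integral_def set_integrable_def scaleR_sum_right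
        by (intro Bochner_Integration.integral_sum[symmetric]) auto
      also have "\<dots> = (LINT x:Q|lebesgue. (A x *v (p + G x)) \<bullet> (\<Sum>k\<in>I. V (x + lat k)))"
        by (simp add: inner_sum_right)
      also have "\<dots> = 0"
        using H1_per_sum_translates[OF N vV] unfolding I_def by (rule test)
      finally show "(LINT x:QN N|lebesgue. (A x *v (p + G x)) \<bullet> V x) = 0" .
    qed
    moreover have "(LINT x:QN N|lebesgue. A x *v (p + G x)) = n *\<^sub>R (LINT x:Q|lebesgue. A x *v (p + G x))"
    proof -
      have "(LINT x:Q|lebesgue. A x *v (p + G (x + lat k))) = (LINT x:Q|lebesgue. A x *v (p + G x))" for k
      proof (rule cong)
        show "AE x in lebesgue. A x *v (p + G (x + lat k)) = A x *v (p + G x)"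
          using Gper[of k] by (rule AE_mp) (intro AE_I2, simp)
      qed (rule flux_shift[OF G, THEN L2_loc_measurable] flux[OF G, THEN L2_loc_measurable])+
      then show ?thesis unfolding cells_flux[OF G] by (simp add: n_def sum_constant_scaleR del: sum_constant)
    qed
    ultimately show ?lhs using y n by (intro exI[of _ w] exI[of _ G]) (simp add: mQN)
  next
    assume ?lhs
    then obtain w G where wG: "H1_per (real N) w G"
      and test: "\<And>v V. H1_per (real N) v V \<Longrightarrow> (LINT x:QN N|lebesgue. (A x *v (p + G x)) \<bullet> V x) = 0"
      and y: "y = (1 / measure lebesgue (QN N :: (real ^ 'd) set)) *\<^sub>R (LINT x:QN N|lebesgue. A x *v (p + G x))"
      unfolding corrector_def QN_def by blast
    have G: "L2_loc G" by (rule H1L2[OF wG])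
    define w' where "w' x = inverse n * (\<Sum>k\<in>I. w (x + lat k))" for x
    define G' where "G' x = inverse n *\<^sub>R (\<Sum>k\<in>I. G (x + lat k))" for x
    have wG': "H1_per 1 w' G'"
      unfolding w'_def G'_def I_def by (rule H1_per_scaleR[OF H1_per_sum_translates[OF N wG]])
    \<comment> \<open>The flux is affine in the gradient, so averaging the gradient averages the flux.\<close>
    have avg: "(\<Sum>k\<in>I. A x *v (p + G (x + lat k))) = n *\<^sub>R (A x *v (p + G' x))" for x
    proof -
      have "(\<Sum>k\<in>I. A x *v (p + G (x + lat k))) = A x *v (\<Sum>k\<in>I. p + G (x + lat k))"
        using linear_sum[OF matrix_vector_mul_linear[of "A x"], of "\<lambda>k. p + G (x + lat k)" I] by simp
      also have "(\<Sum>k\<in>I. p + G (x + lat k)) = n *\<^sub>R (p + G' x)"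
        using n by (simp add: sum.distrib sum_constant_scaleR n_def[symmetric] G'_def scaleR_right_distrib del: sum_constant)
      finally show ?thesis by (simp add: matrix_vector_mult_scaleR)
    qed
    have "corrector 0 1 A p w' G'"
      unfolding corrector_def Q_def[symmetric]
    proof (intro conjI allI impI wG')
      fix v :: "real ^ 'd \<Rightarrow> real" and V assume vV: "H1_per 1 v V"
      have V: "L2_loc V" by (rule H1L2[OF vV])
      have Vper: "AE x in lebesgue. V (x + lat k) = V x" for k
        using H1_per_gradient_periodic[OF vV, of k] by simp
      have "0 = (LINT x:QN N|lebesgue. (A x *v (p + G x)) \<bullet> V x)"
        using test[OF H1_per_1_imp_N[OF vV]] by simp
      also have "\<dots> = (\<Sum>k\<in>I. LINT x:Q|lebesgue. (A x *v (p + G (x + lat k))) \<bullet> V (x + lat k))"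
        by (rule cells_energy[OF G V])
      also have "\<dots> = (\<Sum>k\<in>I. LINT x:Q|lebesgue. (A x *v (p + G (x + lat k))) \<bullet> V x)"
      proof (rule sum.cong[OF refl], rule cong)
        fix k
        show "AE x in lebesgue. (A x *v (p + G (x + lat k))) \<bullet> V (x + lat k) = (A x *v (p + G (x + lat k))) \<bullet> V x"
          using Vper[of k] by (rule AE_mp) (intro AE_I2, simp)
      qed (rule borel_measurable_inner[OF flux_shift[OF G, THEN L2_loc_measurable] L2_loc_shift[OF V, THEN L2_loc_measurable]]
          borel_measurable_inner[OF flux_shift[OF G, THEN L2_loc_measurable] V[THEN L2_loc_measurable]])+
      also have "\<dots> = (LINT x:Q|lebesgue. (\<Sum>k\<in>I. (A x *v (p + G (x + lat k))) \<bullet> V x))"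
        using L2_loc_inner_integrable[OF flux_shift[OF G] V bS(3,4)]
        unfolding set_lebesgue_integral_def set_integrable_def scaleR_sum_right
        by (intro Bochner_Integration.integral_sum[symmetric]) auto
      also have "\<dots> = (LINT x:Q|lebesgue. n *\<^sub>R ((A x *v (p + G' x)) \<bullet> V x))"
        by (simp add: inner_sum_left[symmetric] avg)
      also have "\<dots> = n * (LINT x:Q|lebesgue. (A x *v (p + G' x)) \<bullet> V x)"
        by (simp add: set_integral_mult_right)
      finally show "(LINT x:Q|lebesgue. (A x *v (p + G' x)) \<bullet> V x) = 0" using n by simp
    qed
    moreover have "(LINT x:QN N|lebesgue. A x *v (p + G x)) = n *\<^sub>R (LINT x:Q|lebesgue. A x *v (p + G' x))"
    proof -
      have "(\<Sum>k\<in>I. LINT x:Q|lebesgue. A x *v (p + G (x + lat k)))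
          = (LINT x:Q|lebesgue. (\<Sum>k\<in>I. A x *v (p + G (x + lat k))))"
        using L2_loc_set_integrable[OF flux_shift[OF G] bS(3,4)]
        unfolding set_lebesgue_integral_def set_integrable_def scaleR_sum_right
        by (intro Bochner_Integration.integral_sum[symmetric]) auto
      also have "\<dots> = n *\<^sub>R (LINT x:Q|lebesgue. A x *v (p + G' x))"
        unfolding avg set_lebesgue_integral_def
        by (simp add: scaleR_left_commute[of _ n] del: scaleR_scaleR)
      finally show ?thesis unfolding cells_flux[OF G] .
    qed
    ultimately show ?rhs using y n by (intro exI[of _ w'] exI[of _ G']) (simp add: mQN)
  qed
qed

text \<open>
  The two matrices are definite descriptions, and the predicates inside them coincide.
\<close>

lemma HomN_periodic:
  fixes A :: "real ^ 'd::finite \<Rightarrow> real ^ 'd ^ 'd" and N :: nat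
  assumes "N > 0" "even N" "A \<in> borel_measurable lebesgue" "periodic 1 A" "bounded (range A)"
  shows "HomN N A = Aper_star A"
  unfolding HomN_def Aper_star_def hom_matrix_def
  unfolding QN_def[symmetric] Q_def[symmetric] corrector_value_cell_iff[OF assms] ..

section \<open>Variances of functions of finitely many Bernoulli variables\<close>

definition ones :: "'k set \<Rightarrow> ('k \<Rightarrow> real) \<Rightarrow> 'k set" where
  "ones I b = {k \<in> I. b k = 1}"

context prob_space
begin

lemma variance_add_const:
  fixes Y :: "'a \<Rightarrow> real"
  assumes "integrable M Y" "integrable M (\<lambda>\<omega>. (Y \<omega>)\<^sup>2)"
    and X: "\<And>\<omega>. \<omega> \<in> space M \<Longrightarrow> X \<omega> = Y \<omega> + a"
  shows "variance X = expectation (\<lambda>\<omega>. (Y \<omega>)\<^sup>2) - (expectation Y)\<^sup>2"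
proof -
  have "expectation X = expectation (\<lambda>\<omega>. Y \<omega> + a)"
    by (rule Bochner_Integration.integral_cong) (simp_all add: X)
  also have "\<dots> = expectation Y + a" using assms(1) by (simp add: prob_space)
  finally have "variance X = variance Y"
    by (intro Bochner_Integration.integral_cong) (simp_all add: X)
  then show ?thesis using variance_eq[OF assms(1,2)] by simp
qed

context
  fixes \<eta> :: real and B :: "'k \<Rightarrow> 'a \<Rightarrow> real" and I :: "'k set"
  assumes \<eta>: "0 < \<eta>" "\<eta> < 1" and B: "iid_bernoulli M \<eta> B" and I: "finite I"
begin

abbreviation "ones_at \<omega> \<equiv> ones I (\<lambda>k. B k \<omega>)"

lemma B_measurable: "B k \<in> borel_measurable M"
  using B by (auto simp: iid_bernoulli_def indep_vars_def)

lemma ones_event: "{\<omega> \<in> space M. ones_at \<omega> = T} \<in> events"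
proof -
  have "{\<omega> \<in> space M. ones_at \<omega> = T} = {\<omega> \<in> space M. T \<subseteq> I \<and> (\<forall>k\<in>I. B k \<omega> = 1 \<longleftrightarrow> k \<in> T)}"
    by (auto simp: ones_def)
  also have "\<dots> \<in> events"
    using I B_measurable by measurable
  finally show ?thesis .
qed

text \<open>
  The event requires in particular that the variables indexed by \<open>T\<close> equal 1; the possible zeros
  outside \<open>T\<close> only decrease its probability.
\<close>

lemma prob_ones_le: "T \<subseteq> I \<Longrightarrow> prob {\<omega> \<in> space M. ones_at \<omega> = T} \<le> \<eta> ^ card T"
proof (cases "T = {}")
  case False
  assume T: "T \<subseteq> I"
  then have fin: "finite T" using I finite_subset by blast
  have ev: "B k -` {1} \<inter> space M \<in> events" for k
    using measurable_sets[OF B_measurable, of "{1}"] by simp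
  have "prob {\<omega> \<in> space M. ones_at \<omega> = T} \<le> prob (\<Inter>k\<in>T. B k -` {1} \<inter> space M)"
    using False fin ev by (intro finite_measure_mono sets.finite_INT) (auto simp: ones_def)
  also have "\<dots> = (\<Prod>k\<in>T. prob (B k -` {1} \<inter> space M))"
    using B False fin by (intro indep_varsD[where M'="\<lambda>_. borel" and I=UNIV]) (auto simp: iid_bernoulli_def)
  also have "\<dots> = (\<Prod>k\<in>T. \<eta>)"
  proof (rule prod.cong[OF refl])
    fix k
    have "B k -` {1} \<inter> space M = {\<omega> \<in> space M. B k \<omega> = 1}" by auto
    then show "prob (B k -` {1} \<inter> space M) = \<eta>" using B by (simp add: iid_bernoulli_def)
  qed
  finally show ?thesis by simp
qed simp

lemma function_of_ones_expand:
  fixes f :: "'k set \<Rightarrow> real"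
  assumes "\<omega> \<in> space M"
  shows "f (ones_at \<omega>) = (\<Sum>T\<in>Pow I. f T * indicator {\<omega> \<in> space M. ones_at \<omega> = T} \<omega>)"
proof -
  have "ones_at \<omega> \<in> Pow I" by (auto simp: ones_def)
  have "(\<Sum>T\<in>Pow I. f T * indicator {\<omega> \<in> space M. ones_at \<omega> = T} \<omega>) = (\<Sum>T\<in>Pow I. if T = ones_at \<omega> then f T else 0)"
    using assms by (intro sum.cong) (auto simp: indicator_def)
  also have "\<dots> = f (ones_at \<omega>)" using I \<open>ones_at \<omega> \<in> Pow I\<close> by simp
  finally show ?thesis by simp
qed

lemma
  fixes f :: "'k set \<Rightarrow> real"
  shows function_of_ones_integrable: "integrable M (\<lambda>\<omega>. f (ones_at \<omega>))"
    and expectation_function_of_ones: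
      "expectation (\<lambda>\<omega>. f (ones_at \<omega>)) = (\<Sum>T\<in>Pow I. f T * prob {\<omega> \<in> space M. ones_at \<omega> = T})"
proof -
  have int: "integrable M (\<lambda>\<omega>. f T * indicator {\<omega> \<in> space M. ones_at \<omega> = T} \<omega>)" for T
    using ones_event[of T] by (intro integrable_mult_right integrable_real_indicator) (auto simp: emeasure_eq_measure)
  have "integrable M (\<lambda>\<omega>. f (ones_at \<omega>)) \<longleftrightarrow>
      integrable M (\<lambda>\<omega>. \<Sum>T\<in>Pow I. f T * indicator {\<omega> \<in> space M. ones_at \<omega> = T} \<omega>)"
    by (rule Bochner_Integration.integrable_cong[OF refl function_of_ones_expand])
  also have "\<dots>" by (intro Bochner_Integration.integrable_sum int)
  finally show "integrable M (\<lambda>\<omega>. f (ones_at \<omega>))" .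
  have "expectation (\<lambda>\<omega>. f (ones_at \<omega>)) = expectation (\<lambda>\<omega>. \<Sum>T\<in>Pow I. f T * indicator {\<omega> \<in> space M. ones_at \<omega> = T} \<omega>)"
    by (rule Bochner_Integration.integral_cong[OF refl function_of_ones_expand])
  also have "\<dots> = (\<Sum>T\<in>Pow I. expectation (\<lambda>\<omega>. f T * indicator {\<omega> \<in> space M. ones_at \<omega> = T} \<omega>))"
    by (rule Bochner_Integration.integral_sum[OF int])
  also have "\<dots> = (\<Sum>T\<in>Pow I. f T * prob {\<omega> \<in> space M. ones_at \<omega> = T})"
    using ones_event by (intro sum.cong refl) simp
  finally show "expectation (\<lambda>\<omega>. f (ones_at \<omega>)) = (\<Sum>T\<in>Pow I. f T * prob {\<omega> \<in> space M. ones_at \<omega> = T})" .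
qed

text \<open>
  The constant does not depend on \<open>\<eta>\<close>: this is the source of all error terms.
\<close>

lemma expectation_vanishing_order:
  fixes f :: "'k set \<Rightarrow> real"
  assumes f: "\<And>T. T \<subseteq> I \<Longrightarrow> card T < m \<Longrightarrow> f T = 0"
  shows "\<bar>expectation (\<lambda>\<omega>. f (ones_at \<omega>))\<bar> \<le> (\<Sum>T\<in>Pow I. \<bar>f T\<bar>) * \<eta> ^ m"
proof -
  have "\<bar>f T * prob {\<omega> \<in> space M. ones_at \<omega> = T}\<bar> \<le> \<bar>f T\<bar> * \<eta> ^ m" if T: "T \<in> Pow I" for T
  proof (cases "card T < m")
    case False
    have "prob {\<omega> \<in> space M. ones_at \<omega> = T} \<le> \<eta> ^ card T" using T by (intro prob_ones_le) simp
    also have "\<dots> \<le> \<eta> ^ m" using False \<eta> by (intro power_decreasing) auto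
    finally show ?thesis by (simp add: abs_mult mult_left_mono)
  qed (use f T in auto)
  then show ?thesis
    unfolding expectation_function_of_ones sum_distrib_right
    by (intro order_trans[OF sum_abs] sum_mono)
qed

lemma expectation_sum_ones:
  fixes g :: "'k \<Rightarrow> real"
  shows "expectation (\<lambda>\<omega>. \<Sum>k\<in>ones_at \<omega>. g k) = \<eta> * (\<Sum>k\<in>I. g k)"
proof -
  have ev: "{\<omega> \<in> space M. B k \<omega> = 1} \<in> events" for k
    using B_measurable[of k] by measurable
  have "expectation (\<lambda>\<omega>. \<Sum>k\<in>ones_at \<omega>. g k)
      = expectation (\<lambda>\<omega>. \<Sum>k\<in>I. g k * indicator {\<omega> \<in> space M. B k \<omega> = 1} \<omega>)"
  proof (rule Bochner_Integration.integral_cong[OF refl])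
    fix \<omega> assume "\<omega> \<in> space M"
    then show "(\<Sum>k\<in>ones_at \<omega>. g k) = (\<Sum>k\<in>I. g k * indicator {\<omega> \<in> space M. B k \<omega> = 1} \<omega>)"
      unfolding ones_def sum.inter_filter[OF I] by (intro sum.cong refl) auto
  qed
  also have "\<dots> = (\<Sum>k\<in>I. g k * prob {\<omega> \<in> space M. B k \<omega> = 1})"
    using ev by (subst Bochner_Integration.integral_sum) (auto simp: emeasure_eq_measure intro!: integrable_mult_right)
  also have "\<dots> = \<eta> * (\<Sum>k\<in>I. g k)"
    using B by (simp add: iid_bernoulli_def sum_distrib_left mult.commute)
  finally show ?thesis .
qed

lemma variance_vanishing_order:
  fixes f :: "'k set \<Rightarrow> real"
  assumes f: "\<And>T. T \<subseteq> I \<Longrightarrow> card T < m \<Longrightarrow> f T = 0"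
    and X: "\<And>\<omega>. \<omega> \<in> space M \<Longrightarrow> X \<omega> = f (ones_at \<omega>) + a"
  shows "\<bar>variance X\<bar> \<le> (\<Sum>T\<in>Pow I. (f T)\<^sup>2) * \<eta> ^ m"
proof -
  have "variance X \<le> expectation (\<lambda>\<omega>. (f (ones_at \<omega>))\<^sup>2)"
    using variance_add_const[OF function_of_ones_integrable
        function_of_ones_integrable[of "\<lambda>T. (f T)\<^sup>2"] X] by simp
  also have "\<dots> \<le> (\<Sum>T\<in>Pow I. (f T)\<^sup>2) * \<eta> ^ m"
    using expectation_vanishing_order[of m "\<lambda>T. (f T)\<^sup>2"] f by simp
  finally show ?thesis by (simp add: variance_positive)
qed

text \<open>
  Write \<open>(g T)\<^sup>2\<close> as \<open>\<Sum>\<^sub>k\<^sub>\<in>\<^sub>T (g {k})\<^sup>2\<close> plus a remainder that vanishes on sets with at most one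
  element. The first part has expectation exactly \<open>\<eta> \<Sum>\<^sub>k (g {k})\<^sup>2\<close>, the remainder has one of
  order \<open>\<eta>\<^sup>2\<close>, and the expectation of \<open>g T\<close> itself is of order \<open>\<eta>\<close>, so that its square is harmless.
\<close>

lemma variance_first_order:
  fixes F :: "'k set \<Rightarrow> real"
  assumes X: "\<And>\<omega>. \<omega> \<in> space M \<Longrightarrow> X \<omega> = F (ones_at \<omega>)"
  defines "g \<equiv> \<lambda>T. F T - F {}"
  shows "\<bar>variance X - \<eta> * (\<Sum>k\<in>I. (g {k})\<^sup>2)\<bar>
    \<le> ((\<Sum>T\<in>Pow I. \<bar>(g T)\<^sup>2 - (\<Sum>k\<in>T. (g {k})\<^sup>2)\<bar>) + (\<Sum>T\<in>Pow I. \<bar>g T\<bar>)\<^sup>2) * \<eta>\<^sup>2"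
proof -
  define h where "h = (\<lambda>T. (g T)\<^sup>2 - (\<Sum>k\<in>T. (g {k})\<^sup>2))"
  have "variance X = expectation (\<lambda>\<omega>. (g (ones_at \<omega>))\<^sup>2) - (expectation (\<lambda>\<omega>. g (ones_at \<omega>)))\<^sup>2"
    by (rule variance_add_const[OF function_of_ones_integrable
        function_of_ones_integrable[of "\<lambda>T. (g T)\<^sup>2"], where a="F {}"]) (simp add: X g_def)
  also have "expectation (\<lambda>\<omega>. (g (ones_at \<omega>))\<^sup>2)
      = expectation (\<lambda>\<omega>. h (ones_at \<omega>) + (\<Sum>k\<in>ones_at \<omega>. (g {k})\<^sup>2))"
    by (simp add: h_def)
  also have "\<dots> = expectation (\<lambda>\<omega>. h (ones_at \<omega>)) + \<eta> * (\<Sum>k\<in>I. (g {k})\<^sup>2)"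
    by (subst Bochner_Integration.integral_add[OF function_of_ones_integrable
        function_of_ones_integrable[of "\<lambda>T. \<Sum>k\<in>T. (g {k})\<^sup>2"]]) (simp add: expectation_sum_ones)
  finally have "variance X - \<eta> * (\<Sum>k\<in>I. (g {k})\<^sup>2)
      = expectation (\<lambda>\<omega>. h (ones_at \<omega>)) - (expectation (\<lambda>\<omega>. g (ones_at \<omega>)))\<^sup>2"
    by simp
  then have "\<bar>variance X - \<eta> * (\<Sum>k\<in>I. (g {k})\<^sup>2)\<bar>
      \<le> \<bar>expectation (\<lambda>\<omega>. h (ones_at \<omega>))\<bar> + \<bar>expectation (\<lambda>\<omega>. g (ones_at \<omega>))\<bar>\<^sup>2"
    using abs_triangle_ineq4[of "expectation (\<lambda>\<omega>. h (ones_at \<omega>))" "(expectation (\<lambda>\<omega>. g (ones_at \<omega>)))\<^sup>2"] by simp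
  also have "\<dots> \<le> (\<Sum>T\<in>Pow I. \<bar>h T\<bar>) * \<eta>\<^sup>2 + ((\<Sum>T\<in>Pow I. \<bar>g T\<bar>) * \<eta> ^ 1)\<^sup>2"
  proof (intro add_mono power_mono expectation_vanishing_order)
    fix T assume T: "T \<subseteq> I" "card T < 2"
    have "finite T" using T(1) I finite_subset by blast
    then have "T = {} \<or> (\<exists>k. T = {k})"
      using T(2) by (metis card_0_eq card_1_singletonE less_2_cases One_nat_def)
    then show "h T = 0" by (auto simp: h_def g_def)
  next
    fix T assume T: "T \<subseteq> I" "card T < 1"
    then have "T = {}" using I finite_subset by (metis card_0_eq less_one)
    then show "g T = 0" by (simp add: g_def)
  qed simp
  finally show ?thesis by (simp add: h_def power_mult_distrib algebra_simps)
qed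

end

end

section \<open>Expansion in the number of defects\<close>

lemma HomN_cong:
  assumes "\<And>x. x \<in> QN N \<Longrightarrow> A x = A' x"
  shows "HomN N A = HomN N A'"
proof -
  have A: "A x = A' x" if "x \<in> cube (- (real N / 2)) (real N)" for x
    using that assms by (simp add: QN_def)
  let ?\<chi> = "\<lambda>x. indicator (cube (- (real N / 2)) (real N)) x :: real"
  have eq: "?\<chi> x *\<^sub>R (A x *v y) = ?\<chi> x *\<^sub>R (A' x *v y)"
    "?\<chi> x *\<^sub>R ((A x *v y) \<bullet> z) = ?\<chi> x *\<^sub>R ((A' x *v y) \<bullet> z)" for x y z
    using A by (auto simp: indicator_def)
  show ?thesis
    unfolding HomN_def hom_matrix_def corrector_def set_lebesgue_integral_def eq ..
qed

definition with_defects ::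
  "(real ^ 'd \<Rightarrow> real ^ 'd ^ 'd) \<Rightarrow> (real ^ 'd \<Rightarrow> real ^ 'd ^ 'd) \<Rightarrow> (int ^ 'd) set \<Rightarrow>
     real ^ 'd \<Rightarrow> real ^ 'd ^ 'd::finite" where
  "with_defects A C T x = A x + indicator (\<Union>k\<in>T. cell k) x *\<^sub>R (C x - A x)"

text \<open>
  The infinite lattice sum has at most one nonzero term, and for a point of the cube the index of
  that term lies in \<^term>\<open>IN N\<close>.
\<close>

lemma A_eta_eq_with_defects:
  assumes N: "N > 0" "even N" and x: "x \<in> QN N" and b: "\<And>k. b k \<in> {0, 1}"
  shows "A_eta A C b x = with_defects A C (ones (IN N) b) x"
proof -
  have "(\<Sum>\<^sub>\<infinity>k. indicator (cell k) x * b k) = (indicator (\<Union>k\<in>ones (IN N) b. cell k) x :: real)"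
  proof (cases "\<exists>k. x \<in> cell k")
    case True
    then obtain k where k: "x \<in> cell k" by blast
    have other: "x \<notin> cell l" if "l \<noteq> k" for l using that k cell_unique by blast
    have "k \<in> IN N" by (rule cell_meets_QN[OF N k x])
    have "(\<Sum>\<^sub>\<infinity>k. indicator (cell k) x * b k) = (\<Sum>\<^sub>\<infinity>l\<in>{k}. indicator (cell l) x * b l)"
      by (rule infsum_cong_neutral) (auto simp: other)
    also have "\<dots> = indicator (cell k) x * b k"
      by (subst infsum_finite) (simp, simp only: sum.insert[OF finite.emptyI] empty_iff sum.empty not_False_eq_True add_0_right)
    also have "\<dots> = indicator (\<Union>k\<in>ones (IN N) b. cell k) x"
    proof (cases "b k = 1")
      case True
      then show ?thesis using k \<open>k \<in> IN N\<close> by (auto simp: ones_def indicator_def)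
    next
      case False
      then have "b k = 0" using b[of k] by simp
      moreover have "x \<notin> (\<Union>k\<in>ones (IN N) b. cell k)"
      proof
        assume "x \<in> (\<Union>k\<in>ones (IN N) b. cell k)"
        then obtain l where "b l = 1" "x \<in> cell l" by (auto simp: ones_def)
        then show False using False other by metis
      qed
      ultimately show ?thesis by simp
    qed
    finally show ?thesis .
  qed (auto intro: infsum_0)
  then show ?thesis by (simp add: A_eta_def with_defects_def)
qed

lemma HomN_with_one_defect: "HomN N (with_defects A C {k}) = A1_star N A C k"
  by (simp add: with_defects_def[abs_def] A1_star_def)

lemma HomN_with_two_defects:
  assumes "k \<noteq> l" shows "HomN N (with_defects A C {k, l}) = A2_star N A C k l"
proof -
  have "(indicator (\<Union>k\<in>{k, l}. cell k) x :: real) = indicator (cell k) x + indicator (cell l) x" for x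
    using assms cell_unique[of x k l] by (auto simp: indicator_def)
  then show ?thesis by (simp add: with_defects_def[abs_def] A2_star_def)
qed

theorem lemma14:
  fixes N :: nat and c :: real
    and Aper Cper :: "real ^ 'd \<Rightarrow> real ^ 'd ^ 'd::finite"
    and M :: "'w measure" and B :: "real \<Rightarrow> int ^ 'd \<Rightarrow> 'w \<Rightarrow> real"
    and i j :: 'd
  assumes N: "N > 0" "even N"
    and A: "Aper \<in> borel_measurable lebesgue" "periodic 1 Aper" "bounded (range Aper)"
    and C: "Cper \<in> borel_measurable lebesgue" "periodic 1 Cper" "bounded (range Cper)"
    and ell: "c > 0" "elliptic c Aper" "elliptic c Cper"
    and M: "prob_space M"
    and B: "\<And>\<eta>. \<eta> \<in> {0<..<1} \<Longrightarrow> iid_bernoulli M \<eta> (B \<eta>)"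
  shows "(\<exists>C0\<ge>0. ((\<exists>k\<in>IN N. A1_def N Aper Cper k $ i $ j \<noteq> 0) \<longrightarrow> C0 > 0) \<and>
      (\<lambda>\<eta>. prob_space.variance M (\<lambda>\<omega>. A_star N Aper Cper (\<lambda>k. B \<eta> k \<omega>) $ i $ j) - \<eta> * C0)
        \<in> O[at_right 0](\<lambda>\<eta>. \<eta>\<^sup>2))
    \<and> (\<lambda>\<eta>. prob_space.variance M (\<lambda>\<omega>. D1 N Aper Cper 1 \<eta> (\<lambda>k. B \<eta> k \<omega>) $ i $ j))
        \<in> O[at_right 0](\<lambda>\<eta>. \<eta>\<^sup>2)
    \<and> (\<lambda>\<eta>. prob_space.variance M (\<lambda>\<omega>. D2 N Aper Cper 1 1 \<eta> (\<lambda>k. B \<eta> k \<omega>) $ i $ j))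
        \<in> O[at_right 0](\<lambda>\<eta>. \<eta> ^ 3)"
proof -
  interpret prob_space M by (rule M)
  define I :: "(int ^ 'd) set" where "I = IN N"
  have I: "finite I" unfolding I_def by (rule finite_IN[OF N])
  define F where "F T = HomN N (with_defects Aper Cper T) $ i $ j" for T
  define a1 where "a1 k = F {k} - F {}" for k
  define a2 where "a2 k l = F {k, l} - F {k} - F {l} + F {}" for k l
  \<comment> \<open>This identity turns \<open>A1_def\<close> and \<open>A2_def\<close> into finite differences of \<open>F\<close>.\<close>
  have F0: "F {} = Aper_star Aper $ i $ j"
    using HomN_periodic[OF N A] by (simp add: F_def with_defects_def[abs_def])
  have F1: "F {k} = A1_star N Aper Cper k $ i $ j" for k
    by (simp add: F_def HomN_with_one_defect)
  have F2: "F {k, l} = A2_star N Aper Cper k l $ i $ j" if "k \<noteq> l" for k l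
    using that by (simp add: F_def HomN_with_two_defects)
  have A1: "A1_def N Aper Cper k $ i $ j = a1 k" for k
    by (simp add: A1_def_def a1_def F0 F1)
  have A2: "A2_def N Aper Cper k l $ i $ j = a2 k l" if "k \<noteq> l" for k l
    using that by (simp add: A2_def_def a2_def F0 F1 F2)
  have a2_sym: "a2 k l = a2 l k" for k l by (simp add: a2_def insert_commute)

  have b01: "B \<eta> k \<omega> \<in> {0, 1}" if "\<eta> \<in> {0<..<1}" "\<omega> \<in> space M" for \<eta> k \<omega>
    using B[OF that(1)] that(2) by (simp add: iid_bernoulli_def)
  have Astar: "A_star N Aper Cper b $ i $ j = F (ones I b)" if b: "\<And>k. b k \<in> {0, 1}" for b
    using HomN_cong[of N "A_eta Aper Cper b" "with_defects Aper Cper (ones (IN N) b)"]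
      A_eta_eq_with_defects[OF N _ b, of _ Aper Cper] by (simp add: A_star_def F_def I_def)
  have sum_b: "(\<Sum>k\<in>J. b k * g k) = (\<Sum>k\<in>ones J b. g k)" if "finite J" "\<And>k. b k \<in> {0, 1}"
    for J and b g :: "int ^ 'd \<Rightarrow> real"
  proof -
    have "b k * g k = (if b k = 1 then g k else 0)" for k using that(2)[of k] by auto
    then show ?thesis by (simp add: ones_def sum.inter_filter[OF that(1)])
  qed
  have A1eta: "A1_eta N Aper Cper b $ i $ j = (\<Sum>k\<in>ones I b. a1 k)" if "\<And>k. b k \<in> {0, 1}" for b
    using sum_b[OF I, of b a1] that by (simp add: A1_eta_def I_def[symmetric] A1)
  have A2eta: "A2_eta N Aper Cper b $ i $ j = (1/2) * (\<Sum>k\<in>ones I b. \<Sum>l\<in>ones I b - {k}. a2 k l)"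
    if b: "\<And>k. b k \<in> {0, 1}" for b
  proof -
    have "(\<Sum>k\<in>I. \<Sum>l\<in>I - {k}. b k * b l * A2_def N Aper Cper k l $ i $ j)
        = (\<Sum>k\<in>I. b k * (\<Sum>l\<in>I - {k}. b l * a2 k l))"
      unfolding sum_distrib_left by (intro sum.cong refl) (auto simp: A2)
    also have "\<dots> = (\<Sum>k\<in>ones I b. \<Sum>l\<in>I - {k}. b l * a2 k l)"
      by (rule sum_b[OF I b])
    also have "\<dots> = (\<Sum>k\<in>ones I b. \<Sum>l\<in>ones (I - {k}) b. a2 k l)"
      using I by (intro sum.cong refl sum_b b) auto
    also have "\<dots> = (\<Sum>k\<in>ones I b. \<Sum>l\<in>ones I b - {k}. a2 k l)"
    proof -
      have "ones (I - {k}) b = ones I b - {k}" for k by (auto simp: ones_def)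
      then show ?thesis by simp
    qed
    finally show ?thesis by (simp add: A2_eta_def I_def[symmetric])
  qed

  \<comment> \<open>The parts of \<open>F\<close> that are left by a first-order and by a second-order expansion in defects.\<close>
  define f1 where "f1 T = F T - F {} - (\<Sum>k\<in>T. a1 k)" for T
  define f2 where "f2 T = f1 T - (1/2) * (\<Sum>k\<in>T. \<Sum>l\<in>T - {k}. a2 k l)" for T
  have card_less_2: "T = {} \<or> (\<exists>k. T = {k})" if "T \<subseteq> I" "card T < 2" for T
    using that finite_subset[OF _ I] by (metis card_0_eq card_1_singletonE less_2_cases One_nat_def)
  have f1: "f1 T = 0" if "T \<subseteq> I" "card T < 2" for T
    using card_less_2[OF that] by (auto simp: f1_def a1_def)
  have f2: "f2 T = 0" if T: "T \<subseteq> I" "card T < 3" for T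
  proof (cases "card T < 2")
    case True
    then show ?thesis using card_less_2[OF T(1)] f1[OF T(1)] by (auto simp: f2_def)
  next
    case False
    then have "card T = 2" using T(2) by simp
    then obtain k l where T: "T = {k, l}" "k \<noteq> l" by (auto simp: card_2_iff)
    then have "T - {k} = {l}" "T - {l} = {k}" by auto
    then show ?thesis using T by (simp add: f2_def f1_def a2_sym[of l k]) (simp add: a1_def a2_def)
  qed

  have small: "\<forall>\<^sub>F \<eta> in at_right 0. \<eta> \<in> {0<..<1::real}"
    by (intro eventually_at_right_less[THEN eventually_mono] eventually_at_rightI[of 0 1]) auto
  have bigo: "X \<in> O[at_right 0](\<lambda>\<eta>. \<eta> ^ m)" if "\<And>\<eta>. \<eta> \<in> {0<..<1} \<Longrightarrow> \<bar>X \<eta>\<bar> \<le> K * \<eta> ^ m"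
    for X :: "real \<Rightarrow> real" and K m
    by (rule bigoI[of _ K]) (use small in \<open>eventually_elim, use that in force\<close>)

  show ?thesis
  proof (intro conjI exI[of _ "\<Sum>k\<in>I. (a1 k)\<^sup>2"] impI)
    show "0 \<le> (\<Sum>k\<in>I. (a1 k)\<^sup>2)" by (intro sum_nonneg) auto
    show "0 < (\<Sum>k\<in>I. (a1 k)\<^sup>2)" if "\<exists>k\<in>IN N. A1_def N Aper Cper k $ i $ j \<noteq> 0"
      using that I unfolding I_def[symmetric] A1 by (auto intro: sum_pos2)
    show "(\<lambda>\<eta>. variance (\<lambda>\<omega>. A_star N Aper Cper (\<lambda>k. B \<eta> k \<omega>) $ i $ j) - \<eta> * (\<Sum>k\<in>I. (a1 k)\<^sup>2))
        \<in> O[at_right 0](\<lambda>\<eta>. \<eta>\<^sup>2)"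
      unfolding a1_def
    proof (rule bigo, rule variance_first_order[OF _ _ B I])
      fix \<eta> :: real and \<omega> assume "\<eta> \<in> {0<..<1}" "\<omega> \<in> space M"
      then show "A_star N Aper Cper (\<lambda>k. B \<eta> k \<omega>) $ i $ j = F (ones I (\<lambda>k. B \<eta> k \<omega>))"
        by (intro Astar b01)
    qed auto
    show "(\<lambda>\<eta>. variance (\<lambda>\<omega>. D1 N Aper Cper 1 \<eta> (\<lambda>k. B \<eta> k \<omega>) $ i $ j)) \<in> O[at_right 0](\<lambda>\<eta>. \<eta>\<^sup>2)"
    proof (rule bigo)
      fix \<eta> :: real assume \<eta>: "\<eta> \<in> {0<..<1}"
      show "\<bar>variance (\<lambda>\<omega>. D1 N Aper Cper 1 \<eta> (\<lambda>k. B \<eta> k \<omega>) $ i $ j)\<bar> \<le> (\<Sum>T\<in>Pow I. (f1 T)\<^sup>2) * \<eta>\<^sup>2"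
      proof (rule variance_vanishing_order[OF _ _ B[OF \<eta>] I f1])
        fix \<omega> assume \<omega>: "\<omega> \<in> space M"
        show "D1 N Aper Cper 1 \<eta> (\<lambda>k. B \<eta> k \<omega>) $ i $ j
            = f1 (ones I (\<lambda>k. B \<eta> k \<omega>)) + (F {} + \<eta> * A1_bar N Aper Cper $ i $ j)"
          using b01[OF \<eta> \<omega>] by (simp add: D1_def f1_def Astar A1eta)
      qed (use \<eta> in auto)
    qed
    show "(\<lambda>\<eta>. variance (\<lambda>\<omega>. D2 N Aper Cper 1 1 \<eta> (\<lambda>k. B \<eta> k \<omega>) $ i $ j)) \<in> O[at_right 0](\<lambda>\<eta>. \<eta> ^ 3)"
    proof (rule bigo)
      fix \<eta> :: real assume \<eta>: "\<eta> \<in> {0<..<1}"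
      show "\<bar>variance (\<lambda>\<omega>. D2 N Aper Cper 1 1 \<eta> (\<lambda>k. B \<eta> k \<omega>) $ i $ j)\<bar> \<le> (\<Sum>T\<in>Pow I. (f2 T)\<^sup>2) * \<eta> ^ 3"
      proof (rule variance_vanishing_order[OF _ _ B[OF \<eta>] I f2])
        fix \<omega> assume \<omega>: "\<omega> \<in> space M"
        show "D2 N Aper Cper 1 1 \<eta> (\<lambda>k. B \<eta> k \<omega>) $ i $ j
            = f2 (ones I (\<lambda>k. B \<eta> k \<omega>))
              + (F {} + \<eta> * A1_bar N Aper Cper $ i $ j + \<eta>\<^sup>2 * A2_bar N Aper Cper $ i $ j)"
          using b01[OF \<eta> \<omega>] by (simp add: D2_def f2_def f1_def Astar A1eta A2eta)
      qed (use \<eta> in auto)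
    qed
  qed
qed

end
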